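(* Let $\Phi$ and $\Psi$ be locally convex spaces. Suppose that $\Psi$ is bornological and that $\Phi$ is reflexive. Then the map from $b\mathcal P(\Psi,\Phi)$ into $\mathcal L(\Psi,\mathcal L_b(\Phi',b\mathcal P))$ defined by $$R\mapsto\big[\psi\mapsto\big(f\mapsto\langle f,R\psi\rangle\big)\big]$$ is a linear isomorphism (i.e. a linear bijection).
   Context: $(\Omega,\mathscr F,\mathbb P)$ is a complete probability space with a filtration $(\mathcal F_t)_{t\ge 0}$ satisfying the usual conditions. $b\mathcal P$ is the Banach space of bounded real predictable processes $h:\mathbb R_+\times\Omega\to\mathbb R$ with the uniform norm. All locally convex spaces are real; $\Phi'$ denotes the topological dual with the strong topology, $\langle\cdot,\cdot\rangle$ the duality pairing. $\mathcal L(E,F)$ is the space of continuous linear operators from $E$ to $F$, and $\mathcal L_b(E,F)$ is this space with the topology of uniform convergence on bounded subsets of $E$. For locally convex spaces $\Psi,\Phi$, $b\mathcal P(\Psi,\Phi)$ is the linear space of mappings $R:\mathbb R_+\times\Omega\to\mathcal L(\Psi,\Phi)$ that are (i) weakly predictable: for all $f\in\Phi'$, $\psi\in\Psi$ the map $(t,\omega)\mapsto\langle f,R(t,\omega)\psi\rangle$ is predictable; and (ii) weakly bounded: for every bounded $B\subseteq\Psi$ and every $f\in\Phi'$, $\sup_{\psi\in B}\sup_{(t,\omega)}|\langle f,R(t,\omega)\psi\rangle|<\infty$. In the displayed map, $\langle f,R\psi\rangle$ denotes the process $(t,\omega)\mapsto\langle f,R(t,\omega)\psi\rangle$. *)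

theory Defs
  imports "HOL-Probability.Probability" "HOL-Library.Function_Algebras"
begin

section \<open>Pointwise real vector space structure on functions\<close>

instantiation "fun" :: (type, real_vector) real_vector
begin

definition scaleR_fun :: "real \<Rightarrow> ('a \<Rightarrow> 'b) \<Rightarrow> 'a \<Rightarrow> 'b"
  where "scaleR_fun c f = (\<lambda>x. c *\<^sub>R f x)"

instance
  by standard (auto simp: scaleR_fun_def plus_fun_def scaleR_add_right scaleR_add_left)

end

section \<open>Locally convex spaces\<close>

text \<open>
  A locally convex space is given by its topology; the underlying vector space is the
  \<^const>\<open>topspace\<close>, a linear subspace of an ambient type of class
  \<^class>\<open>real_vector\<close>. Having the carrier as a set is what allows spaces of operators
  to be treated as locally convex spaces again. The Hausdorff property is not
  part of the definition.
\<close>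

definition locally_convex_space :: "'a::real_vector topology \<Rightarrow> bool" where
  "locally_convex_space E \<longleftrightarrow>
     subspace (topspace E) \<and>
     continuous_map (prod_topology E E) E (\<lambda>(x, y). x + y) \<and>
     continuous_map (prod_topology euclideanreal E) E (\<lambda>(c, x). c *\<^sub>R x) \<and>
     (\<forall>U. openin E U \<and> 0 \<in> U \<longrightarrow> (\<exists>V. openin E V \<and> 0 \<in> V \<and> convex V \<and> V \<subseteq> U))"

definition absorbs :: "'a::real_vector set \<Rightarrow> 'a set \<Rightarrow> bool" where
  "absorbs U B \<longleftrightarrow> (\<exists>r>0. \<forall>c. r \<le> \<bar>c\<bar> \<longrightarrow> B \<subseteq> (\<lambda>x. c *\<^sub>R x) ` U)"

definition bounded_in :: "'a::real_vector topology \<Rightarrow> 'a set \<Rightarrow> bool" where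
  "bounded_in E B \<longleftrightarrow> B \<subseteq> topspace E \<and> (\<forall>U. openin E U \<and> 0 \<in> U \<longrightarrow> absorbs U B)"

definition balanced :: "'a::real_vector set \<Rightarrow> bool" where
  "balanced U \<longleftrightarrow> (\<forall>c. \<forall>x\<in>U. \<bar>c\<bar> \<le> 1 \<longrightarrow> c *\<^sub>R x \<in> U)"

text \<open>Every convex balanced set that absorbs all bounded sets is a neighbourhood of 0.\<close>

definition bornological :: "'a::real_vector topology \<Rightarrow> bool" where
  "bornological E \<longleftrightarrow>
     locally_convex_space E \<and>
     (\<forall>U. U \<subseteq> topspace E \<and> convex U \<and> balanced U \<and> (\<forall>B. bounded_in E B \<longrightarrow> absorbs U B)
        \<longrightarrow> (\<exists>V. openin E V \<and> 0 \<in> V \<and> V \<subseteq> U))"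

section \<open>Spaces of continuous linear operators\<close>

text \<open>
  Operators are total functions that vanish outside the carrier of their domain, so that
  equality of functions is equality of operators and the operators form a linear subspace of
  the function type.
\<close>

definition linear_ops ::
    "'a::real_vector topology \<Rightarrow> 'b::real_vector topology \<Rightarrow> ('a \<Rightarrow> 'b) set" where
  "linear_ops E F = {u.
     continuous_map E F u \<and>
     (\<forall>x\<in>topspace E. \<forall>y\<in>topspace E. u (x + y) = u x + u y) \<and>
     (\<forall>c. \<forall>x\<in>topspace E. u (c *\<^sub>R x) = c *\<^sub>R u x) \<and>
     (\<forall>x. x \<notin> topspace E \<longrightarrow> u x = 0)}"

text \<open>
  The basic neighbourhoods of \<open>u\<close> in the topology of uniform convergence on bounded sets are
  the sets of all \<open>v\<close> with \<open>(v - u) ` B \<subseteq> U\<close>, where \<open>B\<close> is bounded and \<open>U\<close> is an open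
  neighbourhood of 0.
\<close>

definition Lb_open ::
    "'a::real_vector topology \<Rightarrow> 'b::real_vector topology \<Rightarrow> ('a \<Rightarrow> 'b) set \<Rightarrow> bool" where
  "Lb_open E F W \<longleftrightarrow>
     W \<subseteq> linear_ops E F \<and>
     (\<forall>u\<in>W. \<exists>B U. bounded_in E B \<and> openin F U \<and> 0 \<in> U \<and>
        {v \<in> linear_ops E F. \<forall>x\<in>B. v x - u x \<in> U} \<subseteq> W)"

definition Lb ::
    "'a::real_vector topology \<Rightarrow> 'b::real_vector topology \<Rightarrow> ('a \<Rightarrow> 'b) topology" where
  "Lb E F = topology (Lb_open E F)"

lemma bounded_in_Un:
  assumes "bounded_in E A" "bounded_in E B"
  shows "bounded_in E (A \<union> B)"
  unfolding bounded_in_def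
proof (intro conjI allI impI)
  show "A \<union> B \<subseteq> topspace E"
    using assms by (auto simp: bounded_in_def)
next
  fix U assume U: "openin E U \<and> 0 \<in> U"
  obtain r s where rs: "r > 0" "\<forall>c. r \<le> \<bar>c\<bar> \<longrightarrow> A \<subseteq> (\<lambda>x. c *\<^sub>R x) ` U"
      "\<forall>c. s \<le> \<bar>c\<bar> \<longrightarrow> B \<subseteq> (\<lambda>x. c *\<^sub>R x) ` U"
    using assms U unfolding bounded_in_def absorbs_def by meson
  show "absorbs U (A \<union> B)"
    unfolding absorbs_def
    using rs by (intro exI[of _ "max r s"]) (simp add: max_def split: if_splits)
qed

lemma bounded_in_empty [simp]: "bounded_in E {}"
  by (auto simp: bounded_in_def absorbs_def intro: exI[of _ 1])

lemma istopology_Lb_open: "istopology (Lb_open E F)"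
  unfolding istopology_def
proof (intro conjI allI impI)
  fix S T assume S: "Lb_open E F S" and T: "Lb_open E F T"
  show "Lb_open E F (S \<inter> T)"
    unfolding Lb_open_def
  proof (intro conjI ballI)
    show "S \<inter> T \<subseteq> linear_ops E F"
      using S by (auto simp: Lb_open_def)
  next
    fix u assume u: "u \<in> S \<inter> T"
    obtain A U where A: "bounded_in E A" "openin F U" "0 \<in> U"
        "{v \<in> linear_ops E F. \<forall>x\<in>A. v x - u x \<in> U} \<subseteq> S"
      using S u unfolding Lb_open_def by blast
    obtain B V where B: "bounded_in E B" "openin F V" "0 \<in> V"
        "{v \<in> linear_ops E F. \<forall>x\<in>B. v x - u x \<in> V} \<subseteq> T"
      using T u unfolding Lb_open_def by blast
    show "\<exists>B U. bounded_in E B \<and> openin F U \<and> 0 \<in> U \<and>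
        {v \<in> linear_ops E F. \<forall>x\<in>B. v x - u x \<in> U} \<subseteq> S \<inter> T"
      using A B by (intro exI[of _ "A \<union> B"] exI[of _ "U \<inter> V"]) (auto intro: bounded_in_Un)
  qed
next
  fix \<K> :: "('a \<Rightarrow> 'b) set set" assume "\<forall>K\<in>\<K>. Lb_open E F K"
  then have K: "Lb_open E F K" if "K \<in> \<K>" for K
    using that by blast
  show "Lb_open E F (\<Union>\<K>)"
    unfolding Lb_open_def
  proof (intro conjI ballI)
    show "\<Union>\<K> \<subseteq> linear_ops E F"
      using K by (auto simp: Lb_open_def)
  next
    fix u assume "u \<in> \<Union>\<K>"
    then obtain S where S: "S \<in> \<K>" "u \<in> S" by blast
    then obtain B U where "bounded_in E B" "openin F U" "0 \<in> U"
        "{v \<in> linear_ops E F. \<forall>x\<in>B. v x - u x \<in> U} \<subseteq> S"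
      using K[OF S(1)] unfolding Lb_open_def by blast
    then show "\<exists>B U. bounded_in E B \<and> openin F U \<and> 0 \<in> U \<and>
        {v \<in> linear_ops E F. \<forall>x\<in>B. v x - u x \<in> U} \<subseteq> \<Union>\<K>"
      using S(1) by blast
  qed
qed

lemma openin_Lb: "openin (Lb E F) W \<longleftrightarrow> Lb_open E F W"
  by (simp add: Lb_def istopology_Lb_open)

lemma topspace_Lb:
  assumes "0 \<in> topspace F"
  shows "topspace (Lb E F) = linear_ops E F"
proof
  show "topspace (Lb E F) \<subseteq> linear_ops E F"
    by (metis Lb_open_def openin_Lb openin_topspace)
  have "Lb_open E F (linear_ops E F)"
    unfolding Lb_open_def using assms
    by (intro conjI ballI exI[of _ "{}"] exI[of _ "topspace F"]) auto
  then show "linear_ops E F \<subseteq> topspace (Lb E F)"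
    by (simp add: openin_Lb openin_subset)
qed

definition strong_dual :: "'a::real_vector topology \<Rightarrow> ('a \<Rightarrow> real) topology" where
  "strong_dual E = Lb E euclideanreal"

definition dual_eval :: "'a::real_vector topology \<Rightarrow> 'a \<Rightarrow> ('a \<Rightarrow> real) \<Rightarrow> real" where
  "dual_eval E x = (\<lambda>f. if f \<in> topspace (strong_dual E) then f x else 0)"

definition reflexive :: "'a::real_vector topology \<Rightarrow> bool" where
  "reflexive E \<longleftrightarrow> locally_convex_space E \<and>
     homeomorphic_map E (strong_dual (strong_dual E)) (dual_eval E)"

definition linear_isomorphism_on ::
    "'a::real_vector set \<Rightarrow> 'b::real_vector set \<Rightarrow> ('a \<Rightarrow> 'b) \<Rightarrow> bool" where
  "linear_isomorphism_on V W T \<longleftrightarrow>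
     subspace V \<and> subspace W \<and>
     (\<forall>x\<in>V. \<forall>y\<in>V. T (x + y) = T x + T y) \<and>
     (\<forall>c. \<forall>x\<in>V. T (c *\<^sub>R x) = c *\<^sub>R T x) \<and>
     bij_betw T V W"

section \<open>Stochastic basis and predictable processes\<close>

text \<open>
  The filtration is indexed by \<^typ>\<open>real\<close>; only its values at times \<open>t \<ge> 0\<close> are constrained
  or used.
\<close>

locale stochastic_basis = prob_space M + complete_measure M for M :: "'w measure" +
  fixes F :: "real \<Rightarrow> 'w measure"
  assumes subalgebra_F: "0 \<le> t \<Longrightarrow> subalgebra M (F t)"
    and F_mono: "0 \<le> s \<Longrightarrow> s \<le> t \<Longrightarrow> sets (F s) \<subseteq> sets (F t)"
    and F_right_continuous: "0 \<le> t \<Longrightarrow> sets (F t) = (\<Inter>s\<in>{t<..}. sets (F s))"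
    and null_sets_F: "null_sets M \<subseteq> sets (F 0)"

definition time_space :: "'w measure \<Rightarrow> (real \<times> 'w) set" where
  "time_space M = {0..} \<times> space M"

definition predictable :: "'w measure \<Rightarrow> (real \<Rightarrow> 'w measure) \<Rightarrow> (real \<times> 'w) measure" where
  "predictable M F = sigma (time_space M)
     ({{0} \<times> A | A. A \<in> sets (F 0)} \<union>
      {{s<..t} \<times> A | s t A. 0 \<le> s \<and> s < t \<and> A \<in> sets (F s)})"

text \<open>As for operators, processes are set to zero outside \<^const>\<open>time_space\<close>.\<close>

definition bP_set :: "'w measure \<Rightarrow> (real \<Rightarrow> 'w measure) \<Rightarrow> (real \<times> 'w \<Rightarrow> real) set" where
  "bP_set M F = {h. h \<in> borel_measurable (predictable M F) \<and>
     bounded (h ` time_space M) \<and> (\<forall>z. z \<notin> time_space M \<longrightarrow> h z = 0)}"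

text \<open>The distance is 0 off \<^const>\<open>bP_set\<close> only because \<^locale>\<open>Metric_space\<close> requires it to be
  non-negative at all arguments.\<close>

definition bP_dist ::
    "'w measure \<Rightarrow> (real \<Rightarrow> 'w measure) \<Rightarrow> (real \<times> 'w \<Rightarrow> real) \<Rightarrow> (real \<times> 'w \<Rightarrow> real) \<Rightarrow> real" where
  "bP_dist M F g h =
     (if g \<in> bP_set M F \<and> h \<in> bP_set M F then (SUP z\<in>time_space M. \<bar>g z - h z\<bar>) else 0)"

definition bP :: "'w measure \<Rightarrow> (real \<Rightarrow> 'w measure) \<Rightarrow> (real \<times> 'w \<Rightarrow> real) topology" where
  "bP M F = Metric_space.mtopology (bP_set M F) (bP_dist M F)"

lemma (in stochastic_basis) Metric_space_bP: "Metric_space (bP_set M F) (bP_dist M F)"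
proof -
  have ne: "time_space M \<noteq> {}"
    using not_empty by (auto simp: time_space_def)
  have bd: "bdd_above ((\<lambda>z. \<bar>g z - h z\<bar>) ` time_space M)"
    if gh: "g \<in> bP_set M F" "h \<in> bP_set M F" for g h
  proof -
    obtain a where a: "\<forall>z\<in>time_space M. \<bar>g z\<bar> \<le> a"
      using gh(1) unfolding bP_set_def bounded_iff real_norm_def by blast
    obtain b where b: "\<forall>z\<in>time_space M. \<bar>h z\<bar> \<le> b"
      using gh(2) unfolding bP_set_def bounded_iff real_norm_def by blast
    show ?thesis
    proof (rule bdd_aboveI2)
      fix z assume "z \<in> time_space M"
      then have "\<bar>g z\<bar> \<le> a" "\<bar>h z\<bar> \<le> b"
        using a b by auto
      then show "\<bar>g z - h z\<bar> \<le> a + b"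
        by linarith
    qed
  qed
  have le: "\<bar>g z - h z\<bar> \<le> bP_dist M F g h"
    if "g \<in> bP_set M F" "h \<in> bP_set M F" "z \<in> time_space M" for g h z
    using bd[OF that(1,2)] that by (auto simp: bP_dist_def intro: cSUP_upper)
  show ?thesis
  proof (unfold_locales)
    fix g h show "0 \<le> bP_dist M F g h"
    proof (cases "g \<in> bP_set M F \<and> h \<in> bP_set M F")
      case True
      then show ?thesis
        using ne le[of g h] by (meson abs_ge_zero all_not_in_conv order_trans)
    qed (auto simp: bP_dist_def)
    show "bP_dist M F g h = bP_dist M F h g"
      by (auto simp: bP_dist_def abs_minus_commute)
  next
    fix g h assume gh: "g \<in> bP_set M F" "h \<in> bP_set M F"
    have "g = h" if "bP_dist M F g h = 0"
    proof
      fix z show "g z = h z"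
      proof (cases "z \<in> time_space M")
        case True
        then show ?thesis
          using le[OF gh, of z] that by simp
      next
        case False
        then show ?thesis
          using gh by (simp add: bP_set_def del: split_paired_All)
      qed
    qed
    moreover have "bP_dist M F g g = 0"
      using gh ne by (simp add: bP_dist_def)
    ultimately show "bP_dist M F g h = 0 \<longleftrightarrow> g = h"
      by auto
  next
    fix f g h assume fgh: "f \<in> bP_set M F" "g \<in> bP_set M F" "h \<in> bP_set M F"
    have "\<bar>f z - h z\<bar> \<le> bP_dist M F f g + bP_dist M F g h" if "z \<in> time_space M" for z
      using le[OF fgh(1,2) that] le[OF fgh(2,3) that] by linarith
    then have "(SUP z\<in>time_space M. \<bar>f z - h z\<bar>) \<le> bP_dist M F f g + bP_dist M F g h"
      using ne by (intro cSUP_least)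
    then show "bP_dist M F f h \<le> bP_dist M F f g + bP_dist M F g h"
      using fgh by (simp add: bP_dist_def)
  qed
qed

definition bP_ops ::
    "'w measure \<Rightarrow> (real \<Rightarrow> 'w measure) \<Rightarrow> 'a::real_vector topology \<Rightarrow> 'b::real_vector topology
      \<Rightarrow> (real \<times> 'w \<Rightarrow> 'a \<Rightarrow> 'b) set" where
  "bP_ops M F \<Psi> \<Phi> = {R.
     (\<forall>z\<in>time_space M. R z \<in> linear_ops \<Psi> \<Phi>) \<and>
     (\<forall>z. z \<notin> time_space M \<longrightarrow> R z = 0) \<and>
     (\<forall>f\<in>topspace (strong_dual \<Phi>). \<forall>\<psi>\<in>topspace \<Psi>.
        (\<lambda>z. f (R z \<psi>)) \<in> borel_measurable (predictable M F)) \<and>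
     (\<forall>B. bounded_in \<Psi> B \<longrightarrow> (\<forall>f\<in>topspace (strong_dual \<Phi>).
        bdd_above {\<bar>f (R z \<psi>)\<bar> | \<psi> z. \<psi> \<in> B \<and> z \<in> time_space M}))}"

text \<open>
  \<open>f (R z \<psi>)\<close> already vanishes for \<open>\<psi>\<close> outside the carrier and for \<open>z\<close> outside
  \<^const>\<open>time_space\<close>, so only \<open>f\<close> has to be restricted to the dual.
\<close>

definition pairing_map ::
    "'b::real_vector topology \<Rightarrow> (real \<times> 'w \<Rightarrow> 'a::real_vector \<Rightarrow> 'b)
      \<Rightarrow> 'a \<Rightarrow> ('b \<Rightarrow> real) \<Rightarrow> real \<times> 'w \<Rightarrow> real" where
  "pairing_map \<Phi> R = (\<lambda>\<psi> f. if f \<in> topspace (strong_dual \<Phi>) then (\<lambda>z. f (R z \<psi>)) else 0)"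

end

theory Submission
  imports Defs
begin

text \<open>
  The key fact is that a weakly bounded \<open>C \<subseteq> \<Phi>\<close> is uniformly bounded against every strongly
  bounded \<open>B \<subseteq> \<Phi>'\<close>: since \<open>\<Phi>\<close> carries the topology of the strong bidual, \<open>B\<close> is
  equicontinuous, and a gliding hump argument applies. Consequently \<open>C\<close> is bounded. With
  \<open>C = {R(t,\<omega>)\<psi>}\<close> this makes \<open>f \<mapsto> \<langle>f, R\<psi>\<rangle>\<close> continuous on \<open>\<Phi>'\<close>; letting \<open>\<psi>\<close>
  range over a bounded set, it shows that the convex balanced set of all \<open>\<psi>\<close> with
  \<open>\<bar>\<langle>f, R\<psi>\<rangle>\<bar> \<le> \<epsilon>\<close> for \<open>f \<in> B\<close> absorbs bounded sets, hence is a neighbourhood of 0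
  as \<open>\<Psi>\<close> is bornological. Conversely, for \<open>S\<close> in the target, each
  \<open>f \<mapsto> S \<psi> f (t,\<omega>)\<close> lies in the bidual and is represented by the vector
  \<open>R(t,\<omega>)\<psi>\<close> of \<open>\<Phi>\<close>.
\<close>

section \<open>Linear topologies and continuous linear operators\<close>

lemma scaleR_fun_apply [simp]: "(c *\<^sub>R f) x = c *\<^sub>R f x"
  by (simp add: scaleR_fun_def)

text \<open>
  Weaker than a topological vector space, since scalar multiplication need not be jointly
  continuous: this passes from \<open>F\<close> to \<open>Lb E F\<close> by a short argument and suffices to reduce
  continuity of linear maps to continuity at 0.
\<close>

definition vector_topology :: "'a::real_vector topology \<Rightarrow> bool" where
  "vector_topology E \<longleftrightarrow>
     subspace (topspace E) \<and>
     (\<forall>U. \<forall>a\<in>topspace E. openin E U \<longrightarrow> openin E {x \<in> topspace E. x + a \<in> U}) \<and>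
     (\<forall>U. openin E U \<and> 0 \<in> U \<longrightarrow> (\<exists>V. openin E V \<and> 0 \<in> V \<and> (\<forall>x\<in>V. \<forall>y\<in>V. x + y \<in> U))) \<and>
     (\<forall>U c. openin E U \<and> 0 \<in> U \<longrightarrow> (\<exists>V. openin E V \<and> 0 \<in> V \<and> (\<forall>x\<in>V. c *\<^sub>R x \<in> U)))"

lemma vector_topologyD:
  assumes "vector_topology E"
  shows vector_topology_subspace: "subspace (topspace E)"
    and vector_topology_translate:
      "\<And>U a. a \<in> topspace E \<Longrightarrow> openin E U \<Longrightarrow> openin E {x \<in> topspace E. x + a \<in> U}"
    and vector_topology_add:
      "\<And>U. openin E U \<Longrightarrow> 0 \<in> U \<Longrightarrow> \<exists>V. openin E V \<and> 0 \<in> V \<and> (\<forall>x\<in>V. \<forall>y\<in>V. x + y \<in> U)"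
    and vector_topology_scaleR:
      "\<And>U c. openin E U \<Longrightarrow> 0 \<in> U \<Longrightarrow> \<exists>V. openin E V \<and> 0 \<in> V \<and> (\<forall>x\<in>V. c *\<^sub>R x \<in> U)"
  using assms unfolding vector_topology_def by blast+

lemma vector_topology_zero: "vector_topology E \<Longrightarrow> 0 \<in> topspace E"
  by (simp add: vector_topology_subspace subspace_0)

lemma locally_convex_spaceD:
  assumes "locally_convex_space E"
  shows locally_convex_space_subspace: "subspace (topspace E)"
    and locally_convex_space_add: "continuous_map (prod_topology E E) E (\<lambda>(x, y). x + y)"
    and locally_convex_space_scaleR:
      "continuous_map (prod_topology euclideanreal E) E (\<lambda>(c, x). c *\<^sub>R x)"
  using assms unfolding locally_convex_space_def by blast+

text \<open>Each property is a restriction of joint continuity: translation by \<open>a\<close> is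
  addition along \<open>x \<mapsto> (x, a)\<close>, scaling by \<open>c\<close> is scalar
  multiplication along \<open>x \<mapsto> (c, x)\<close>, and the neighbourhood for sums comes from
  a box around \<open>(0, 0)\<close> whose two sides are intersected.\<close>

lemma locally_convex_space_vector_topology:
  assumes "locally_convex_space E"
  shows "vector_topology E"
  unfolding vector_topology_def
proof (intro conjI allI ballI impI)
  show sub: "subspace (topspace E)"
    using assms by (rule locally_convex_space_subspace)
  have add: "continuous_map (prod_topology E E) E (\<lambda>(x, y). x + y)"
    and scale: "continuous_map (prod_topology euclideanreal E) E (\<lambda>(c, x). c *\<^sub>R x)"
    using assms by (rule locally_convex_spaceD)+
  show "openin E {x \<in> topspace E. x + a \<in> U}" if "a \<in> topspace E" "openin E U" for U a
  proof -
    have "continuous_map E (prod_topology E E) (\<lambda>x. (x, a))"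
      using that by (simp add: continuous_map_paired)
    from continuous_map_compose[OF this add] have "continuous_map E E (\<lambda>x. x + a)"
      by (simp add: o_def)
    then show ?thesis
      using that by (simp add: openin_continuous_map_preimage)
  qed
  show "\<exists>V. openin E V \<and> 0 \<in> V \<and> (\<forall>x\<in>V. \<forall>y\<in>V. x + y \<in> U)" if "openin E U \<and> 0 \<in> U" for U
  proof -
    have "openin (prod_topology E E) {p \<in> topspace (prod_topology E E). (\<lambda>(x, y). x + y) p \<in> U}"
      using openin_continuous_map_preimage[OF add] that by blast
    moreover have "(0, 0) \<in> {p \<in> topspace (prod_topology E E). (\<lambda>(x, y). x + y) p \<in> U}"
      using that sub by (simp add: subspace_0)
    ultimately obtain V W where "openin E V" "openin E W" "0 \<in> V" "0 \<in> W"
      "V \<times> W \<subseteq> {p \<in> topspace (prod_topology E E). (\<lambda>(x, y). x + y) p \<in> U}"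
      unfolding openin_prod_topology_alt by meson
    then show ?thesis
      by (intro exI[of _ "V \<inter> W"]) (auto simp: subset_iff)
  qed
  show "\<exists>V. openin E V \<and> 0 \<in> V \<and> (\<forall>x\<in>V. c *\<^sub>R x \<in> U)" if "openin E U \<and> 0 \<in> U" for U c
  proof -
    have "continuous_map E (prod_topology euclideanreal E) (\<lambda>x. (c, x))"
      by (simp add: continuous_map_paired)
    from continuous_map_compose[OF this scale] have "continuous_map E E (\<lambda>x. c *\<^sub>R x)"
      by (simp add: o_def)
    then have "openin E {x \<in> topspace E. c *\<^sub>R x \<in> U}"
      using that by (simp add: openin_continuous_map_preimage)
    then show ?thesis
      using that sub by (intro exI[of _ "{x \<in> topspace E. c *\<^sub>R x \<in> U}"]) (simp add: subspace_0)
  qed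
qed

lemma open_real_ball_zero:
  fixes U :: "real set"
  assumes "open U" "0 \<in> U"
  obtains e where "e > 0" "\<And>x. \<bar>x\<bar> \<le> e \<Longrightarrow> x \<in> U"
proof -
  obtain e where "e > 0" "cball 0 e \<subseteq> U"
    using assms open_contains_cball by blast
  then show ?thesis
    by (intro that[of e]) (auto simp: subset_iff)
qed

lemma vector_topology_real: "vector_topology euclideanreal"
  unfolding vector_topology_def
proof (intro conjI allI ballI impI)
  show "openin euclideanreal {x \<in> topspace euclideanreal. x + a \<in> U}"
    if "openin euclideanreal U" for U and a :: real
  proof -
    have "open ((\<lambda>x. x + a) -` U)"
      using that by (intro open_vimage) (auto intro: continuous_intros)
    then show ?thesis by (simp add: vimage_def)
  qed
  show "\<exists>V. openin euclideanreal V \<and> 0 \<in> V \<and> (\<forall>x\<in>V. \<forall>y\<in>V. x + y \<in> U)"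
    if U: "openin euclideanreal U \<and> 0 \<in> U" for U
  proof -
    obtain e where e: "e > 0" "\<And>x. \<bar>x\<bar> \<le> e \<Longrightarrow> x \<in> U"
      using U open_real_ball_zero by (metis open_openin)
    then show ?thesis
      by (intro exI[of _ "{-e/2<..<e/2}"]) auto
  qed
  show "\<exists>V. openin euclideanreal V \<and> 0 \<in> V \<and> (\<forall>x\<in>V. c *\<^sub>R x \<in> U)"
    if U: "openin euclideanreal U \<and> 0 \<in> U" for U and c :: real
  proof -
    have "open ((\<lambda>x. c * x) -` U)"
      using U by (intro open_vimage) (auto intro: continuous_intros)
    then show ?thesis
      using U by (intro exI[of _ "(\<lambda>x. c * x) -` U"]) auto
  qed
qed auto

lemma linear_opsD:
  assumes "u \<in> linear_ops E F"
  shows linear_ops_in: "\<And>x. x \<in> topspace E \<Longrightarrow> u x \<in> topspace F"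
    and linear_ops_add: "\<And>x y. x \<in> topspace E \<Longrightarrow> y \<in> topspace E \<Longrightarrow> u (x + y) = u x + u y"
    and linear_ops_scaleR: "\<And>c x. x \<in> topspace E \<Longrightarrow> u (c *\<^sub>R x) = c *\<^sub>R u x"
    and linear_ops_out: "\<And>x. x \<notin> topspace E \<Longrightarrow> u x = 0"
  using assms continuous_map_funspace[of E F u] unfolding linear_ops_def by auto

lemma linear_ops_zero:
  assumes "u \<in> linear_ops E F" "vector_topology E"
  shows "u 0 = 0"
  using linear_ops_scaleR[OF assms(1) vector_topology_zero[OF assms(2)], of 0] by simp

text \<open>The default value 0 outside the carrier of \<open>E\<close> also lies in the carrier of
  \<open>F\<close>; this frees later arguments from checking where \<open>x\<close> lies.\<close>

lemma linear_ops_in_topspace: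
  assumes "u \<in> linear_ops E F" "vector_topology F"
  shows "u x \<in> topspace F"
  using linear_ops_in[OF assms(1), of x] linear_ops_out[OF assms(1), of x]
    vector_topology_zero[OF assms(2)] by (cases "x \<in> topspace E") auto

lemma linear_ops_nhd:
  assumes "u \<in> linear_ops E F" "vector_topology E" "openin F U" "0 \<in> U"
  shows "\<exists>V. openin E V \<and> 0 \<in> V \<and> (\<forall>x\<in>V. u x \<in> U)"
proof -
  have "openin E {x \<in> topspace E. u x \<in> U}"
    using assms openin_continuous_map_preimage[of E F u U] by (simp add: linear_ops_def)
  then show ?thesis
    using assms linear_ops_zero[OF assms(1,2)] vector_topology_zero[OF assms(2)]
    by (intro exI[of _ "{x \<in> topspace E. u x \<in> U}"]) auto
qed

text \<open>By linearity, continuity at \<open>a\<close> is continuity at 0 moved by translations in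
  both spaces: if \<open>u\<close> maps \<open>V\<close> into \<open>U - u a\<close>, it maps
  \<open>V + a\<close> into \<open>U\<close>.\<close>

lemma linear_opsI:
  assumes E: "vector_topology E" and F: "vector_topology F"
    and into: "\<And>x. x \<in> topspace E \<Longrightarrow> u x \<in> topspace F"
    and add: "\<And>x y. x \<in> topspace E \<Longrightarrow> y \<in> topspace E \<Longrightarrow> u (x + y) = u x + u y"
    and scaleR: "\<And>c x. x \<in> topspace E \<Longrightarrow> u (c *\<^sub>R x) = c *\<^sub>R u x"
    and out: "\<And>x. x \<notin> topspace E \<Longrightarrow> u x = 0"
    and nhd: "\<And>U. openin F U \<Longrightarrow> 0 \<in> U \<Longrightarrow> \<exists>V. openin E V \<and> 0 \<in> V \<and> (\<forall>x\<in>V. u x \<in> U)"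
  shows "u \<in> linear_ops E F"
proof -
  have "openin E {x \<in> topspace E. u x \<in> U}" if U: "openin F U" for U
  proof (subst openin_subopen, intro ballI)
    fix a assume "a \<in> {x \<in> topspace E. u x \<in> U}"
    then have a: "a \<in> topspace E" "u a \<in> U" by auto
    have ma: "- a \<in> topspace E"
      using a vector_topology_subspace[OF E] by (simp add: subspace_neg)
    have "openin F {y \<in> topspace F. y + u a \<in> U}"
      using vector_topology_translate[OF F into[OF a(1)] U] .
    moreover have "0 \<in> {y \<in> topspace F. y + u a \<in> U}"
      using a vector_topology_zero[OF F] by simp
    ultimately obtain V where V: "openin E V" "0 \<in> V" "\<forall>x\<in>V. u x \<in> {y \<in> topspace F. y + u a \<in> U}"
      using nhd by meson
    have "openin E {x \<in> topspace E. x + - a \<in> V}"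
      using vector_topology_translate[OF E ma V(1)] .
    moreover have "a \<in> {x \<in> topspace E. x + - a \<in> V}"
      using a V by simp
    moreover have "{x \<in> topspace E. x + - a \<in> V} \<subseteq> {x \<in> topspace E. u x \<in> U}"
    proof clarify
      fix x assume x: "x \<in> topspace E" "x + - a \<in> V"
      then have "u (x + - a) + u a \<in> U" using V by blast
      moreover have "u (x + - a + a) = u (x + - a) + u a"
        using x a V openin_subset by (intro add) blast+
      ultimately show "u x \<in> U" by simp
    qed
    ultimately show "\<exists>T. openin E T \<and> a \<in> T \<and> T \<subseteq> {x \<in> topspace E. u x \<in> U}"
      by blast
  qed
  then show ?thesis
    using assms by (auto simp: linear_ops_def continuous_map_def)
qed

lemma subspace_linear_ops:
  assumes E: "vector_topology E" and F: "vector_topology F"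
  shows "subspace (linear_ops E F)"
  unfolding subspace_def
proof (intro conjI ballI allI)
  note sF = vector_topology_subspace[OF F]
  show "0 \<in> linear_ops E F"
  proof (intro linear_opsI[OF E F])
    show "\<exists>V. openin E V \<and> 0 \<in> V \<and> (\<forall>x\<in>V. 0 x \<in> U)" if "0 \<in> U" for U
      using that vector_topology_zero[OF E] by (intro exI[of _ "topspace E"]) auto
  qed (simp_all add: vector_topology_zero[OF F])
  show "u + v \<in> linear_ops E F" if u: "u \<in> linear_ops E F" and v: "v \<in> linear_ops E F" for u v
  proof (intro linear_opsI[OF E F])
    show "\<exists>V. openin E V \<and> 0 \<in> V \<and> (\<forall>x\<in>V. (u + v) x \<in> U)" if U: "openin F U" "0 \<in> U" for U
    proof -
      obtain V where V: "openin F V" "0 \<in> V" "\<forall>x\<in>V. \<forall>y\<in>V. x + y \<in> U"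
        using vector_topology_add[OF F U] by blast
      obtain A where A: "openin E A" "0 \<in> A" "\<forall>x\<in>A. u x \<in> V"
        using linear_ops_nhd[OF u E V(1,2)] by blast
      obtain B where B: "openin E B" "0 \<in> B" "\<forall>x\<in>B. v x \<in> V"
        using linear_ops_nhd[OF v E V(1,2)] by blast
      show ?thesis
        using V A B by (intro exI[of _ "A \<inter> B"]) auto
    qed
  qed (auto simp: linear_opsD[OF u] linear_opsD[OF v] sF subspace_add scaleR_add_right)
  show "c *\<^sub>R u \<in> linear_ops E F" if u: "u \<in> linear_ops E F" for c u
  proof (intro linear_opsI[OF E F])
    show "\<exists>V. openin E V \<and> 0 \<in> V \<and> (\<forall>x\<in>V. (c *\<^sub>R u) x \<in> U)" if U: "openin F U" "0 \<in> U" for U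
    proof -
      obtain V where V: "openin F V" "0 \<in> V" "\<forall>x\<in>V. c *\<^sub>R x \<in> U"
        using vector_topology_scaleR[OF F U] by blast
      then show ?thesis
        using linear_ops_nhd[OF u E V(1,2)] by auto
    qed
  qed (auto simp: linear_opsD[OF u] sF subspace_scale scaleR_add_right)
qed

section \<open>The topology of uniform convergence on bounded sets\<close>

lemma Lb_nhd:
  fixes E :: "'a::real_vector topology" and F :: "'b::real_vector topology"
  assumes F: "vector_topology F" and E: "vector_topology E"
    and B: "bounded_in E B" and U: "openin F U" "0 \<in> U"
  shows "\<exists>W. openin (Lb E F) W \<and> 0 \<in> W \<and> (\<forall>v\<in>W. \<forall>x\<in>B. v x \<in> U)"
proof -
  \<comment> \<open>The set of all \<open>v\<close> sending \<open>B\<close> into \<open>U\<close>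
    need not be open, since \<open>v x\<close> may come arbitrarily close to the boundary of
    \<open>U\<close> as \<open>x\<close> runs through \<open>B\<close>. Membership in
    \<open>W\<close> therefore asks for one margin \<open>U'\<close> that serves all
    \<open>x \<in> B\<close>.\<close>
  define W where "W = {v \<in> linear_ops E F.
    \<exists>U'. openin F U' \<and> 0 \<in> U' \<and> (\<forall>x\<in>B. \<forall>y\<in>U'. v x + y \<in> U)}"
  have "Lb_open E F W"
    unfolding Lb_open_def
  proof (intro conjI ballI)
    fix u assume "u \<in> W"
    then obtain U' where U': "openin F U'" "0 \<in> U'" "\<forall>x\<in>B. \<forall>y\<in>U'. u x + y \<in> U"
      unfolding W_def by blast
    \<comment> \<open>The margin is split in two: one summand from \<open>V\<close> pays for moving
      from \<open>u\<close> to \<open>v\<close>, the other is the margin that \<open>v\<close>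
      keeps.\<close>
    obtain V where V: "openin F V" "0 \<in> V" "\<forall>x\<in>V. \<forall>y\<in>V. x + y \<in> U'"
      using vector_topology_add[OF F U'(1,2)] by blast
    have "v x + y \<in> U" if "v x - u x \<in> V" "x \<in> B" "y \<in> V" for v :: "'a \<Rightarrow> 'b" and x y
    proof -
      have "(v x - u x) + y \<in> U'"
        using that(1,3) V(3) by blast
      with that(2) U'(3) have "u x + ((v x - u x) + y) \<in> U"
        by blast
      then show ?thesis by simp
    qed
    then have "v \<in> W" if "v \<in> linear_ops E F" "\<forall>x\<in>B. v x - u x \<in> V" for v
      unfolding W_def using V(1,2) that by (intro CollectI conjI exI[of _ V]) auto
    then show "\<exists>B U. bounded_in E B \<and> openin F U \<and> 0 \<in> U \<and>
        {v \<in> linear_ops E F. \<forall>x\<in>B. v x - u x \<in> U} \<subseteq> W"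
      using B V(1,2) by (intro exI[of _ B] exI[of _ V]) auto
  qed (auto simp: W_def)
  moreover have "0 \<in> W"
    unfolding W_def using U subspace_0[OF subspace_linear_ops[OF E F]]
    by (intro CollectI conjI exI[of _ U]) auto
  moreover have "v x \<in> U" if "v \<in> W" "x \<in> B" for v x
  proof -
    from that(1) obtain U' where U': "0 \<in> U'" "\<forall>x\<in>B. \<forall>y\<in>U'. v x + y \<in> U"
      by (auto simp: W_def)
    have "v x + 0 \<in> U"
      by (rule U'(2)[rule_format, OF that(2) U'(1)])
    then show ?thesis by simp
  qed
  ultimately show ?thesis
    by (intro exI[of _ W]) (simp add: openin_Lb)
qed

lemma Lb_nhdD:
  assumes "openin (Lb E F) W" "0 \<in> W"
  obtains B U where "bounded_in E B" "openin F U" "0 \<in> U"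
    "\<And>v. v \<in> linear_ops E F \<Longrightarrow> (\<And>x. x \<in> B \<Longrightarrow> v x \<in> U) \<Longrightarrow> v \<in> W"
proof -
  from assms obtain B U where "bounded_in E B" "openin F U" "0 \<in> U"
    "{v \<in> linear_ops E F. \<forall>x\<in>B. v x - 0 x \<in> U} \<subseteq> W"
    unfolding openin_Lb Lb_open_def by blast
  then show ?thesis
    by (intro that[of B U]) auto
qed

text \<open>Translation invariance is immediate because \<open>Lb_open\<close> only involves
  differences \<open>v - u\<close>. Sums and multiples are handled pointwise on the bounded set
  \<open>B\<close> of a basic neighbourhood, with the corresponding property of
  \<open>F\<close>.\<close>

lemma vector_topology_Lb:
  assumes E: "vector_topology E" and F: "vector_topology F"
  shows "vector_topology (Lb E F)"
proof -
  have top: "topspace (Lb E F) = linear_ops E F"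
    by (simp add: topspace_Lb vector_topology_zero[OF F])
  note sub = subspace_linear_ops[OF E F]
  show ?thesis
    unfolding vector_topology_def top
  proof (intro conjI allI ballI impI)
    fix W a assume a: "a \<in> linear_ops E F" and W: "openin (Lb E F) W"
    show "openin (Lb E F) {v \<in> linear_ops E F. v + a \<in> W}"
      unfolding openin_Lb Lb_open_def
    proof (intro conjI ballI)
      fix u assume "u \<in> {v \<in> linear_ops E F. v + a \<in> W}"
      then obtain B U where BU: "bounded_in E B" "openin F U" "0 \<in> U"
        "{v \<in> linear_ops E F. \<forall>x\<in>B. v x - (u + a) x \<in> U} \<subseteq> W"
        using W unfolding openin_Lb Lb_open_def by blast
      have "v + a \<in> W" if "v \<in> linear_ops E F" "\<forall>x\<in>B. v x - u x \<in> U" for v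
        using that a sub by (intro subsetD[OF BU(4)]) (auto intro: subspace_add)
      then show "\<exists>B U. bounded_in E B \<and> openin F U \<and> 0 \<in> U \<and>
          {v \<in> linear_ops E F. \<forall>x\<in>B. v x - u x \<in> U} \<subseteq> {v \<in> linear_ops E F. v + a \<in> W}"
        using BU by blast
    qed auto
  next
    fix W assume "openin (Lb E F) W \<and> 0 \<in> W"
    then obtain B U where BU: "bounded_in E B" "openin F U" "0 \<in> U"
        "\<And>v. v \<in> linear_ops E F \<Longrightarrow> (\<And>x. x \<in> B \<Longrightarrow> v x \<in> U) \<Longrightarrow> v \<in> W"
      using Lb_nhdD by (metis (no_types, lifting))
    obtain V where V: "openin F V" "0 \<in> V" "\<forall>x\<in>V. \<forall>y\<in>V. x + y \<in> U"
      using vector_topology_add[OF F BU(2,3)] by blast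
    obtain W' where W': "openin (Lb E F) W'" "0 \<in> W'" "\<forall>v\<in>W'. \<forall>x\<in>B. v x \<in> V"
      using Lb_nhd[OF F E BU(1) V(1,2)] by blast
    have "W' \<subseteq> linear_ops E F"
      using W'(1) openin_subset top by blast
    then show "\<exists>V. openin (Lb E F) V \<and> 0 \<in> V \<and> (\<forall>x\<in>V. \<forall>y\<in>V. x + y \<in> W)"
      using V W' sub by (intro exI[of _ W']) (auto intro!: BU(4) intro: subspace_add)
  next
    fix W c assume "openin (Lb E F) W \<and> 0 \<in> W"
    then obtain B U where BU: "bounded_in E B" "openin F U" "0 \<in> U"
        "\<And>v. v \<in> linear_ops E F \<Longrightarrow> (\<And>x. x \<in> B \<Longrightarrow> v x \<in> U) \<Longrightarrow> v \<in> W"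
      using Lb_nhdD by (metis (no_types, lifting))
    obtain V where V: "openin F V" "0 \<in> V" "\<forall>x\<in>V. c *\<^sub>R x \<in> U"
      using vector_topology_scaleR[OF F BU(2,3)] by blast
    obtain W' where W': "openin (Lb E F) W'" "0 \<in> W'" "\<forall>v\<in>W'. \<forall>x\<in>B. v x \<in> V"
      using Lb_nhd[OF F E BU(1) V(1,2)] by blast
    have "W' \<subseteq> linear_ops E F"
      using W'(1) openin_subset top by blast
    then show "\<exists>V. openin (Lb E F) V \<and> 0 \<in> V \<and> (\<forall>x\<in>V. c *\<^sub>R x \<in> W)"
      using V W' sub by (intro exI[of _ W']) (auto intro!: BU(4) intro: subspace_scale)
  qed (rule sub)
qed

section \<open>Bounded sets\<close>

lemma absorbs_scaled:
  assumes "absorbs U B"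
  obtains r where "r > 0" "\<And>x. x \<in> B \<Longrightarrow> \<exists>y\<in>U. x = r *\<^sub>R y"
proof -
  obtain r where "r > 0" "\<forall>c. r \<le> \<bar>c\<bar> \<longrightarrow> B \<subseteq> (\<lambda>x. c *\<^sub>R x) ` U"
    using assms unfolding absorbs_def by blast
  then show ?thesis
    by (intro that[of r]) (auto dest!: spec[of _ r])
qed

text \<open>The threshold \<open>r > 0\<close> forces \<open>c \<noteq> 0\<close>, so membership in
  the dilate of \<open>U\<close> by \<open>c\<close> can be tested by dividing by
  \<open>c\<close>.\<close>

lemma absorbsI:
  assumes "r > 0" "\<And>c x. r \<le> \<bar>c\<bar> \<Longrightarrow> x \<in> B \<Longrightarrow> inverse c *\<^sub>R x \<in> U"
  shows "absorbs U B"
  unfolding absorbs_def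
proof (intro exI[of _ r] conjI allI impI subsetI)
  fix c x assume c: "r \<le> \<bar>c\<bar>" and x: "x \<in> B"
  then have "x = c *\<^sub>R (inverse c *\<^sub>R x)" using assms(1) by auto
  then show "x \<in> (\<lambda>x. c *\<^sub>R x) ` U"
    using assms(2)[OF c x] by blast
qed (rule assms(1))

text \<open>Joint continuity of scalar multiplication makes \<open>c \<mapsto> c *\<^sub>R x\<close>
  continuous at 0, so \<open>U\<close> contains \<open>inverse c *\<^sub>R x\<close> for all large
  \<open>\<bar>c\<bar>\<close>. A mere \<open>vector_topology\<close> controls each fixed scalar
  only, hence the stronger hypothesis.\<close>

lemma bounded_in_singleton:
  assumes E: "locally_convex_space E" and x: "x \<in> topspace E"
  shows "bounded_in E {x}"
  unfolding bounded_in_def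
proof (intro conjI allI impI)
  fix U assume U: "openin E U \<and> 0 \<in> U"
  have scale: "continuous_map (prod_topology euclideanreal E) E (\<lambda>(c, x). c *\<^sub>R x)"
    using E by (rule locally_convex_space_scaleR)
  have "continuous_map euclideanreal (prod_topology euclideanreal E) (\<lambda>c. (c, x))"
    using x by (simp add: continuous_map_paired)
  from continuous_map_compose[OF this scale] have "continuous_map euclideanreal E (\<lambda>c. c *\<^sub>R x)"
    by (simp add: o_def)
  then have "openin euclideanreal {c \<in> topspace euclideanreal. c *\<^sub>R x \<in> U}"
    using U openin_continuous_map_preimage by blast
  then have "open {c. c *\<^sub>R x \<in> U}" by simp
  moreover have "0 \<in> {c. c *\<^sub>R x \<in> U}" using U by simp
  ultimately obtain e where e: "e > 0" "\<And>c. \<bar>c\<bar> \<le> e \<Longrightarrow> c \<in> {c. c *\<^sub>R x \<in> U}"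
    by (rule open_real_ball_zero) blast
  show "absorbs U {x}"
  proof (rule absorbsI[of "inverse e"])
    fix c y assume "inverse e \<le> \<bar>c\<bar>" "y \<in> {x}"
    moreover have "\<bar>inverse c\<bar> \<le> e"
      using e(1) \<open>inverse e \<le> \<bar>c\<bar>\<close> by (metis abs_inverse inverse_inverse_eq inverse_le_imp_le
          inverse_positive_iff_positive le_imp_inverse_le)
    ultimately show "inverse c *\<^sub>R y \<in> U" using e(2) by auto
  qed (use e in simp)
qed (use x in simp)

lemma bounded_in_image:
  assumes u: "u \<in> linear_ops E F" and E: "vector_topology E" and B: "bounded_in E B"
  shows "bounded_in F (u ` B)"
  unfolding bounded_in_def
proof (intro conjI allI impI)
  show "u ` B \<subseteq> topspace F"
    using B linear_ops_in[OF u] by (auto simp: bounded_in_def)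
  fix U assume U: "openin F U \<and> 0 \<in> U"
  obtain V where V: "openin E V" "0 \<in> V" "\<forall>x\<in>V. u x \<in> U"
    using linear_ops_nhd[OF u E] U by blast
  obtain r where r: "r > 0" "\<forall>c. r \<le> \<bar>c\<bar> \<longrightarrow> B \<subseteq> (\<lambda>x. c *\<^sub>R x) ` V"
    using B V unfolding bounded_in_def absorbs_def by blast
  show "absorbs U (u ` B)"
    unfolding absorbs_def
  proof (intro exI[of _ r] conjI allI impI r(1) image_subsetI)
    fix c x assume "r \<le> \<bar>c\<bar>" "x \<in> B"
    then obtain y where y: "y \<in> V" "x = c *\<^sub>R y" using r by blast
    then have "u x = c *\<^sub>R u y"
      using linear_ops_scaleR[OF u] openin_subset[OF V(1)] by blast
    then show "u x \<in> (\<lambda>x. c *\<^sub>R x) ` U" using y V by blast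
  qed
qed

text \<open>\<open>Lb E F\<close> is only known to be a \<open>vector_topology\<close>, so
  \<open>bounded_in_singleton\<close> does not apply. Instead, a basic neighbourhood given by
  \<open>B\<close> and \<open>U\<close> absorbs \<open>u\<close> because \<open>U\<close> absorbs
  the image of \<open>B\<close>, which is bounded.\<close>

lemma bounded_in_Lb_singleton:
  assumes E: "vector_topology E" and F: "vector_topology F" and u: "u \<in> linear_ops E F"
  shows "bounded_in (Lb E F) {u}"
  unfolding bounded_in_def
proof (intro conjI allI impI)
  show "{u} \<subseteq> topspace (Lb E F)"
    using u by (simp add: topspace_Lb vector_topology_zero[OF F])
  fix W assume "openin (Lb E F) W \<and> 0 \<in> W"
  then obtain B U where BU: "bounded_in E B" "openin F U" "0 \<in> U"
      "\<And>v. v \<in> linear_ops E F \<Longrightarrow> (\<And>x. x \<in> B \<Longrightarrow> v x \<in> U) \<Longrightarrow> v \<in> W"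
    using Lb_nhdD by (metis (no_types, lifting))
  have "absorbs U (u ` B)"
    using bounded_in_image[OF u E BU(1)] BU by (simp add: bounded_in_def)
  then obtain r where r: "r > 0" "\<forall>c. r \<le> \<bar>c\<bar> \<longrightarrow> u ` B \<subseteq> (\<lambda>x. c *\<^sub>R x) ` U"
    unfolding absorbs_def by blast
  show "absorbs W {u}"
  proof (rule absorbsI[OF r(1)])
    fix c v assume c: "r \<le> \<bar>c\<bar>" and "v \<in> {u}"
    then have v: "v = u" by simp
    show "inverse c *\<^sub>R v \<in> W"
      unfolding v
    proof (rule BU(4))
      show "inverse c *\<^sub>R u \<in> linear_ops E F"
        using u subspace_linear_ops[OF E F] by (simp add: subspace_scale)
      fix x assume "x \<in> B"
      then obtain y where "y \<in> U" "u x = c *\<^sub>R y" using r(2) c by blast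
      moreover have "c \<noteq> 0" using c r(1) by auto
      ultimately show "(inverse c *\<^sub>R u) x \<in> U" by simp
    qed
  qed
qed

section \<open>Uniform boundedness in reflexive spaces\<close>

text \<open>If the bound failed, there would be points \<open>x n\<close> and functions
  \<open>g n\<close> with \<open>g n (x n)\<close> very large and nearly maximal over
  \<open>B\<close>. In the series of the \<open>g n\<close> with weights \<open>(1/3)^n\<close> and
  suitable signs, the \<open>n\<close>-th term cannot be cancelled at \<open>x n\<close> by the
  earlier terms, thanks to its sign, nor by the later ones, thanks to the weights. So the series is
  unbounded on \<open>C\<close>, against \<open>series\<close>.\<close>

lemma gliding_hump:
  fixes B :: "('x \<Rightarrow> real) set"
  assumes pointwise: "\<And>x. x \<in> C \<Longrightarrow> \<exists>K. \<forall>f\<in>B. \<bar>f x\<bar> \<le> K"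
    and series: "\<And>g \<epsilon>. (\<And>n::nat. g n \<in> B) \<Longrightarrow> (\<And>n. \<bar>\<epsilon> n\<bar> \<le> 1) \<Longrightarrow>
      \<exists>K. \<forall>x\<in>C. \<bar>\<Sum>n. \<epsilon> n * (1/3)^n * g n x\<bar> \<le> K"
  shows "\<exists>K. \<forall>f\<in>B. \<forall>x\<in>C. \<bar>f x\<bar> \<le> K"
proof (rule ccontr)
  assume unb: "\<not> ?thesis"
  \<comment> \<open>\<open>Q\<close> will be the supremum of \<open>\<bar>h x\<bar>\<close> over
    \<open>h \<in> B\<close>, finite by \<open>pointwise\<close>. Any factor strictly between 1/2
    and 1 would serve in place of 3/4, since 1/2 is the share that the tail of the series can
    cancel.\<close>
  have "\<exists>x g Q. x \<in> C \<and> g \<in> B \<and> 3^n * real n < Q \<and> 3/4 * Q \<le> \<bar>g x\<bar> \<and> (\<forall>h\<in>B. \<bar>h x\<bar> \<le> Q)" for n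
  proof -
    obtain f x where fx: "f \<in> B" "x \<in> C" "\<bar>f x\<bar> > 3^n * real n"
      using unb by (meson not_le)
    define Q where "Q = (SUP h\<in>B. \<bar>h x\<bar>)"
    have bdd: "bdd_above ((\<lambda>h. \<bar>h x\<bar>) ` B)"
      using pointwise[OF fx(2)] by (auto simp: bdd_above_def)
    have le: "\<bar>h x\<bar> \<le> Q" if "h \<in> B" for h
      unfolding Q_def using that bdd by (rule cSUP_upper)
    have Q: "3^n * real n < Q" using le[OF fx(1)] fx(3) by linarith
    moreover have "(0::real) \<le> 3^n * real n" by simp
    \<comment> \<open>Positivity of \<open>Q\<close> puts \<open>3/4 * Q\<close> strictly below the
      supremum, so some \<open>g \<in> B\<close> exceeds it.\<close>
    ultimately have "3/4 * Q < Q" by linarith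
    then obtain g where "g \<in> B" "3/4 * Q < \<bar>g x\<bar>"
      unfolding Q_def using less_cSUP_iff[OF _ bdd] fx(1) by blast
    then show ?thesis using fx(2) le Q by (meson less_imp_le)
  qed
  then obtain x g Q where x: "\<And>n. x n \<in> C" and g: "\<And>n. g n \<in> B" and Q: "\<And>n. 3^n * real n < Q n"
    and gx: "\<And>n. 3/4 * Q n \<le> \<bar>g n (x n)\<bar>" and le: "\<And>n h. h \<in> B \<Longrightarrow> \<bar>h (x n)\<bar> \<le> Q n"
    by metis
  \<comment> \<open>One of \<open>\<bar>a + b\<bar>\<close> and \<open>\<bar>a - b\<bar>\<close> is
    at least \<open>\<bar>b\<bar>\<close>, as they add up to at least
    \<open>2 * \<bar>b\<bar>\<close>. With \<open>a\<close> the value at \<open>x n\<close> of the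
    preceding partial sum and \<open>b\<close> that of the new term, \<open>sg n\<close> picks a
    sign for which this happens. It takes the partial sum as an argument because \<open>s\<close>
    and the signs arise from one recursion.\<close>
  define sg :: "nat \<Rightarrow> ('x \<Rightarrow> real) \<Rightarrow> real" where
    "sg n s = (if \<bar>s (x n) + (1/3)^n * g n (x n)\<bar> \<ge> (1/3)^n * \<bar>g n (x n)\<bar> then 1 else -1)" for n s
  define s where "s = rec_nat (\<lambda>y. 0) (\<lambda>n s y. s y + sg n s * (1/3)^n * g n y)"
  define \<epsilon> where "\<epsilon> n = sg n (s n)" for n
  have s0: "s 0 = (\<lambda>y. 0)" and sS: "s (Suc n) = (\<lambda>y. s n y + \<epsilon> n * (1/3)^n * g n y)" for n
    by (simp_all add: s_def \<epsilon>_def)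
  have s_sum: "s n y = (\<Sum>k<n. \<epsilon> k * (1/3)^k * g k y)" for n y
    by (induction n) (simp_all add: s0 sS)
  have eps: "\<bar>\<epsilon> n\<bar> = 1" for n by (simp add: \<epsilon>_def sg_def)
  have hump: "\<bar>s (Suc n) (x n)\<bar> \<ge> (1/3)^n * \<bar>g n (x n)\<bar>" for n
  proof -
    have "\<bar>(1/3)^n * g n (x n)\<bar> = (1/3)^n * \<bar>g n (x n)\<bar>" by (simp add: abs_mult)
    then show ?thesis
      unfolding sS \<epsilon>_def sg_def by (auto split: if_splits)
  qed
  obtain K where K: "\<And>y. y \<in> C \<Longrightarrow> \<bar>\<Sum>n. \<epsilon> n * (1/3)^n * g n y\<bar> \<le> K"
    using series[of g \<epsilon>] g eps by auto
  have "real n / 4 \<le> K" for n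
  proof -
    define t where "t k = \<epsilon> k * (1/3)^k * g k (x n)" for k
    have tb: "\<bar>t k\<bar> \<le> (1/3)^k * Q n" for k
      unfolding t_def using le[OF g, of k n] eps by (simp add: abs_mult mult_left_mono)
    have geo: "summable (\<lambda>k. (1/3::real)^k * Q n)"
      by (intro summable_mult2 summable_geometric) simp
    have sumt: "summable t"
      by (rule summable_comparison_test[OF _ geo]) (auto simp: tb)
    \<comment> \<open>\<open>Q n\<close> bounds every member of \<open>B\<close> at
      \<open>x n\<close>, hence all later \<open>g k\<close> as well, and the weights
      \<open>(1/3)^k\<close> with \<open>k > n\<close> add up to half of
      \<open>(1/3)^n\<close>.\<close>
    have tail: "\<bar>\<Sum>k. t (k + Suc n)\<bar> \<le> (1/3)^n * Q n / 2"
    proof -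
      have gs: "(\<lambda>k. (1/3::real)^(k + Suc n) * Q n) sums ((1/3)^n * Q n / 2)"
      proof -
        have "(\<lambda>k. (1/3::real)^k) sums (3/2)"
          using geometric_sums[of "1/3::real"] by simp
        then have "(\<lambda>k. (1/3::real)^k * ((1/3)^Suc n * Q n)) sums (3/2 * ((1/3)^Suc n * Q n))"
          by (rule sums_mult2)
        then show ?thesis by (simp add: power_add mult_ac)
      qed
      have a: "norm (t (k + Suc n)) \<le> (1/3)^(k + Suc n) * Q n" for k
        using tb[of "k + Suc n"] by simp
      have "norm (\<Sum>k. t (k + Suc n)) \<le> (\<Sum>k. (1/3)^(k + Suc n) * Q n)"
        using a sums_summable[OF gs] by (rule norm_suminf_le)
      then show ?thesis using sums_unique[OF gs] by simp
    qed
    \<comment> \<open>The cut is at \<open>Suc n\<close> so that the initial segment ends with the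
      hump, term \<open>n\<close>. What survives is at least \<open>3/4 - 1/2 = 1/4\<close> of
      \<open>(1/3)^n * Q n\<close>.\<close>
    have "(\<Sum>k. t k) = (\<Sum>k. t (k + Suc n)) + (\<Sum>k<Suc n. t k)"
      by (rule suminf_split_initial_segment[OF sumt])
    moreover have "(\<Sum>k<Suc n. t k) = s (Suc n) (x n)"
      unfolding s_sum t_def ..
    moreover have "(1/3)^n * (3/4 * Q n) \<le> (1/3)^n * \<bar>g n (x n)\<bar>"
      using gx[of n] by (intro mult_left_mono) auto
    ultimately have "\<bar>\<Sum>k. t k\<bar> \<ge> (1/3)^n * Q n / 4"
      using hump[of n] tail by linarith
    \<comment> \<open>The factor \<open>3^n\<close> in the lower bound for \<open>Q n\<close>
      cancels the weight, which leaves values of at least \<open>n / 4\<close>.\<close>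
    moreover have "real n \<le> (1/3)^n * Q n"
    proof -
      have "(1/3)^n * (3^n * real n) \<le> (1/3)^n * Q n"
        using Q[of n] by (intro mult_left_mono) auto
      then show ?thesis by (simp add: power_divide)
    qed
    ultimately show ?thesis using K[OF x, of n] unfolding t_def by linarith
  qed
  moreover obtain n :: nat where "real n > 4 * K" using reals_Archimedean2 by blast
  ultimately show False by (metis less_divide_eq_numeral1(1) mult.commute not_le)
qed

section \<open>The strong dual and the canonical map into the strong bidual\<close>

lemma vector_topology_strong_dual:
  "vector_topology E \<Longrightarrow> vector_topology (strong_dual E)"
  unfolding strong_dual_def by (intro vector_topology_Lb vector_topology_real)

lemma topspace_strong_dual: "topspace (strong_dual E) = linear_ops E euclideanreal"
  unfolding strong_dual_def by (simp add: topspace_Lb)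

lemma strong_dual_nhd:
  assumes "vector_topology E" "bounded_in E B" "e > 0"
  shows "\<exists>W. openin (strong_dual E) W \<and> 0 \<in> W \<and> (\<forall>v\<in>W. \<forall>x\<in>B. \<bar>v x\<bar> \<le> e)"
proof -
  have "\<exists>W. openin (strong_dual E) W \<and> 0 \<in> W \<and> (\<forall>v\<in>W. \<forall>x\<in>B. v x \<in> {-e<..<e})"
    unfolding strong_dual_def using assms by (intro Lb_nhd vector_topology_real) auto
  then obtain W where "openin (strong_dual E) W" "0 \<in> W" "\<forall>v\<in>W. \<forall>x\<in>B. v x \<in> {-e<..<e}"
    by blast
  then show ?thesis by (intro exI[of _ W]) (auto simp: abs_le_iff less_imp_le neg_le_iff_le minus_le_iff)
qed

lemma strong_dual_nhdD:
  assumes "openin (strong_dual E) W" "0 \<in> W"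
  obtains B e where "bounded_in E B" "e > 0"
    "\<And>v. v \<in> topspace (strong_dual E) \<Longrightarrow> (\<And>x. x \<in> B \<Longrightarrow> \<bar>v x\<bar> \<le> e) \<Longrightarrow> v \<in> W"
proof -
  obtain B U where BU: "bounded_in E B" "openin euclideanreal U" "0 \<in> U"
    "\<And>v. v \<in> linear_ops E euclideanreal \<Longrightarrow> (\<And>x. x \<in> B \<Longrightarrow> v x \<in> U) \<Longrightarrow> v \<in> W"
    using assms unfolding strong_dual_def by (rule Lb_nhdD) blast
  then have "open U" by simp
  then obtain e where "e > 0" "\<And>x. \<bar>x\<bar> \<le> e \<Longrightarrow> x \<in> U"
    using BU(3) open_real_ball_zero by metis
  then show ?thesis
    using BU by (intro that[of B e]) (auto simp: topspace_strong_dual)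
qed

lemma reflexiveD:
  assumes "reflexive E"
  shows reflexive_vector_topology: "vector_topology E"
    and reflexive_bij:
      "bij_betw (dual_eval E) (topspace E) (topspace (strong_dual (strong_dual E)))"
    and reflexive_dual_eval:
      "\<And>x f. f \<in> topspace (strong_dual E) \<Longrightarrow> dual_eval E x f = f x"
proof -
  show "vector_topology E"
    using assms by (simp add: reflexive_def locally_convex_space_vector_topology)
  show "bij_betw (dual_eval E) (topspace E) (topspace (strong_dual (strong_dual E)))"
    using assms by (simp add: reflexive_def homeomorphic_map_def quotient_imp_surjective_map bij_betw_def)
  show "dual_eval E x f = f x" if "f \<in> topspace (strong_dual E)" for x f
    using that by (simp add: dual_eval_def)
qed

lemma dual_eval_zero:
  assumes "vector_topology E"
  shows "dual_eval E 0 = 0"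
  using linear_ops_zero[OF _ assms] by (fastforce simp: dual_eval_def topspace_strong_dual)

text \<open>Being at most \<open>e\<close> on \<open>B\<close> holds on a neighbourhood of 0 in the
  strong bidual, which pulls back along the continuous map \<open>dual_eval E\<close>. Thus strongly
  bounded sets of functionals are equicontinuous.\<close>

lemma reflexive_nhd:
  assumes "reflexive E" "bounded_in (strong_dual E) B" "e > 0"
  shows "\<exists>V. openin E V \<and> 0 \<in> V \<and> (\<forall>x\<in>V. \<forall>f\<in>B. \<bar>f x\<bar> \<le> e)"
proof -
  note E = reflexive_vector_topology[OF assms(1)]
  obtain W where W: "openin (strong_dual (strong_dual E)) W" "0 \<in> W" "\<forall>v\<in>W. \<forall>f\<in>B. \<bar>v f\<bar> \<le> e"
    using strong_dual_nhd[OF vector_topology_strong_dual[OF E] assms(2,3)] by blast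
  have "continuous_map E (strong_dual (strong_dual E)) (dual_eval E)"
    using assms(1) homeomorphic_imp_continuous_map by (auto simp: reflexive_def)
  then have "openin E {x \<in> topspace E. dual_eval E x \<in> W}"
    using W(1) by (rule openin_continuous_map_preimage)
  moreover have "\<bar>f x\<bar> \<le> e" if "dual_eval E x \<in> W" "f \<in> B" for x f
  proof -
    have "f \<in> topspace (strong_dual E)"
      using that(2) assms(2) by (auto simp: bounded_in_def)
    then show ?thesis
      using W(3) that reflexive_dual_eval[OF assms(1)] by metis
  qed
  ultimately show ?thesis
    using W(2) dual_eval_zero[OF E] vector_topology_zero[OF E]
    by (intro exI[of _ "{x \<in> topspace E. dual_eval E x \<in> W}"]) auto
qed

text \<open>The counterpart of \<open>reflexive_nhd\<close>, resting on openness of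
  \<open>dual_eval E\<close> in place of its continuity. It turns estimates against functionals into
  membership in neighbourhoods of 0.\<close>

lemma reflexive_nhdD:
  assumes "reflexive E" "openin E U" "0 \<in> U"
  obtains B e where "bounded_in (strong_dual E) B" "e > 0"
    "\<And>x. x \<in> topspace E \<Longrightarrow> (\<And>f. f \<in> B \<Longrightarrow> \<bar>f x\<bar> \<le> e) \<Longrightarrow> x \<in> U"
proof -
  note E = reflexive_vector_topology[OF assms(1)]
  have "openin (strong_dual (strong_dual E)) (dual_eval E ` U)"
    using assms homeomorphic_imp_open_map unfolding reflexive_def open_map_def by blast
  moreover have "0 \<in> dual_eval E ` U"
    using assms(3) dual_eval_zero[OF E] by force
  ultimately obtain B e where B: "bounded_in (strong_dual E) B" "e > 0"
    "\<And>v. v \<in> topspace (strong_dual (strong_dual E)) \<Longrightarrow> (\<And>f. f \<in> B \<Longrightarrow> \<bar>v f\<bar> \<le> e)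
      \<Longrightarrow> v \<in> dual_eval E ` U"
    by (rule strong_dual_nhdD) blast
  show ?thesis
  proof (rule that[OF B(1,2)])
    fix x assume x: "x \<in> topspace E" and le: "\<And>f. f \<in> B \<Longrightarrow> \<bar>f x\<bar> \<le> e"
    note bij = reflexive_bij[OF assms(1)]
    have "\<bar>dual_eval E x f\<bar> \<le> e" if "f \<in> B" for f
      using that le B(1) reflexive_dual_eval[OF assms(1), of f x] by (auto simp: bounded_in_def)
    then have "dual_eval E x \<in> dual_eval E ` U"
      using x bij by (intro B(3)) (auto simp: bij_betw_def)
    \<comment> \<open>So far only the image of \<open>x\<close> is known to lie in the image of
      \<open>U\<close>; injectivity on the carrier brings \<open>x\<close> itself back to
      \<open>U\<close>.\<close>
    then show "x \<in> U"
      using x bij openin_subset[OF assms(2)] by (auto simp: bij_betw_def inj_on_def)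
  qed
qed

text \<open>
  Reflexivity makes a strongly bounded set of functionals equicontinuous, so the series in the
  gliding hump argument converges to a continuous functional; no completeness of \<open>E\<close> is involved.
\<close>

lemma reflexive_uniformly_bounded:
  assumes refl: "reflexive E" and C: "C \<subseteq> topspace E"
    and weak: "\<And>f. f \<in> topspace (strong_dual E) \<Longrightarrow> \<exists>K. \<forall>x\<in>C. \<bar>f x\<bar> \<le> K"
    and B: "bounded_in (strong_dual E) B"
  shows "\<exists>K. \<forall>f\<in>B. \<forall>x\<in>C. \<bar>f x\<bar> \<le> K"
proof (rule gliding_hump)
  note E = reflexive_vector_topology[OF refl]
  have lcs: "locally_convex_space E" using refl by (simp add: reflexive_def)
  have Bl: "f \<in> linear_ops E euclideanreal" if "f \<in> B" for f
    using that B by (auto simp: bounded_in_def topspace_strong_dual)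
  \<comment> \<open>Equicontinuity gives a neighbourhood \<open>V\<close> on which all of
    \<open>B\<close> is bounded by 1; the factor \<open>r\<close> with which \<open>V\<close>
    absorbs \<open>x\<close> then bounds \<open>B\<close> at \<open>x\<close>.\<close>
  have ex: "\<exists>K. \<forall>f\<in>B. \<bar>f x\<bar> \<le> K" if x: "x \<in> topspace E" for x
  proof -
    obtain V where V: "openin E V" "0 \<in> V" "\<forall>y\<in>V. \<forall>f\<in>B. \<bar>f y\<bar> \<le> 1"
      using reflexive_nhd[OF refl B zero_less_one] by blast
    have "absorbs V {x}"
      using bounded_in_singleton[OF lcs x] V by (simp add: bounded_in_def)
    then obtain r where r: "r > 0" "\<And>y. y \<in> {x} \<Longrightarrow> \<exists>v\<in>V. y = r *\<^sub>R v"
      by (rule absorbs_scaled) blast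
    then obtain v where v: "v \<in> V" "x = r *\<^sub>R v" by blast
    have "\<bar>f x\<bar> \<le> r" if "f \<in> B" for f
    proof -
      have "f x = r * f v"
        using v linear_ops_scaleR[OF Bl[OF that]] openin_subset[OF V(1)] by auto
      then show ?thesis using V(3) v(1) that r(1) by (simp add: abs_mult mult_left_le)
    qed
    then show ?thesis by blast
  qed
  show "\<exists>K. \<forall>f\<in>B. \<bar>f x\<bar> \<le> K" if "x \<in> C" for x
    using that C ex by blast
  show "\<exists>K. \<forall>x\<in>C. \<bar>\<Sum>n. \<epsilon> n * (1/3)^n * g n x\<bar> \<le> K"
    if g: "\<And>n::nat. g n \<in> B" and eps: "\<And>n. \<bar>\<epsilon> n\<bar> \<le> 1" for g :: "nat \<Rightarrow> 'a \<Rightarrow> real" and \<epsilon>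
  \<comment> \<open>Weak boundedness of \<open>C\<close> is applied to the sum of the series, so it
    remains to see that this sum is a continuous linear functional on \<open>E\<close>.\<close>
  proof (rule weak)
    note gl = Bl[OF g]
    \<comment> \<open>\<open>K\<close> stays a parameter because it takes two kinds of values: a
      bound at a given point for convergence, and \<open>2/3 * e\<close> on a neighbourhood for
      continuity.\<close>
    have bnd: "\<bar>\<epsilon> n * (1/3)^n * g n x\<bar> \<le> (1/3)^n * K"
      if "\<forall>f\<in>B. \<bar>f x\<bar> \<le> K" for n x K
    proof -
      have "\<bar>\<epsilon> n\<bar> * ((1/3)^n * \<bar>g n x\<bar>) \<le> 1 * ((1/3)^n * K)"
        using that g eps by (intro mult_mono mult_left_mono) auto
      then show ?thesis by (simp add: abs_mult mult_ac)
    qed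
    have geo: "(\<lambda>n. (1/3::real)^n * K) sums (3/2 * K)" for K
    proof (rule sums_mult2)
      show "(\<lambda>n. (1/3::real)^n) sums (3/2)"
        using geometric_sums[of "1/3::real"] by simp
    qed
    have summ: "summable (\<lambda>n. \<epsilon> n * (1/3)^n * g n x)"
      if "\<forall>f\<in>B. \<bar>f x\<bar> \<le> K" for x K
      by (rule summable_comparison_test[OF _ sums_summable[OF geo[of K]]])
        (use bnd[OF that] in auto)
    have summ': "summable (\<lambda>n. \<epsilon> n * (1/3)^n * g n x)" if "x \<in> topspace E" for x
      using ex[OF that] summ by blast
    show "(\<lambda>x. \<Sum>n. \<epsilon> n * (1/3)^n * g n x) \<in> topspace (strong_dual E)"
      unfolding topspace_strong_dual
    proof (rule linear_opsI[OF E vector_topology_real])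
      fix x y assume xy: "x \<in> topspace E" "y \<in> topspace E"
      show "(\<Sum>n. \<epsilon> n * (1/3)^n * g n (x + y)) =
          (\<Sum>n. \<epsilon> n * (1/3)^n * g n x) + (\<Sum>n. \<epsilon> n * (1/3)^n * g n y)"
        using xy by (subst suminf_add[OF summ' summ'])
          (auto simp: linear_ops_add[OF gl] algebra_simps)
    next
      fix c x assume x: "x \<in> topspace E"
      show "(\<Sum>n. \<epsilon> n * (1/3)^n * g n (c *\<^sub>R x)) = c *\<^sub>R (\<Sum>n. \<epsilon> n * (1/3)^n * g n x)"
        using x suminf_mult[OF summ'[OF x], of c]
        by (simp add: linear_ops_scaleR[OF gl] mult_ac)
    next
      fix U :: "real set" assume U: "openin euclideanreal U" "0 \<in> U"
      obtain e where e: "e > 0" "\<And>x. \<bar>x\<bar> \<le> e \<Longrightarrow> x \<in> U"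
        using U open_real_ball_zero by (metis open_openin)
      \<comment> \<open>The weights sum to 3/2, so \<open>2/3 * e\<close> for each functional yields
        \<open>e\<close> for the series.\<close>
      obtain V where V: "openin E V" "0 \<in> V" "\<forall>y\<in>V. \<forall>f\<in>B. \<bar>f y\<bar> \<le> 2/3 * e"
        using reflexive_nhd[OF refl B, of "2/3 * e"] e by auto
      have "\<bar>\<Sum>n. \<epsilon> n * (1/3)^n * g n x\<bar> \<le> e" if "x \<in> V" for x
      proof -
        have le: "\<forall>f\<in>B. \<bar>f x\<bar> \<le> 2/3 * e" using V(3) that by blast
        have a: "norm (\<epsilon> n * (1/3)^n * g n x) \<le> (1/3)^n * (2/3 * e)" for n
          using bnd[OF le] by simp
        have "norm (\<Sum>n. \<epsilon> n * (1/3)^n * g n x) \<le> (\<Sum>n. (1/3)^n * (2/3 * e))"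
          using a sums_summable[OF geo] by (rule norm_suminf_le)
        then show ?thesis using sums_unique[OF geo[of "2/3 * e"]] by simp
      qed
      then show "\<exists>V. openin E V \<and> 0 \<in> V \<and> (\<forall>x\<in>V. (\<Sum>n. \<epsilon> n * (1/3)^n * g n x) \<in> U)"
        using V(1,2) e(2) by blast
    qed (auto simp: linear_ops_out[OF gl])
  qed
qed

text \<open>A Mackey type theorem: a neighbourhood of 0 contains a multiple of the polar of a
  strongly bounded set \<open>B\<close>, and the uniform bound of \<open>B\<close> on
  \<open>C\<close> determines a radius from which on \<open>C\<close> is absorbed.\<close>

lemma reflexive_bounded_in:
  assumes refl: "reflexive E" and C: "C \<subseteq> topspace E"
    and weak: "\<And>f. f \<in> topspace (strong_dual E) \<Longrightarrow> \<exists>K. \<forall>x\<in>C. \<bar>f x\<bar> \<le> K"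
  shows "bounded_in E C"
  unfolding bounded_in_def
proof (intro conjI allI impI C)
  note E = reflexive_vector_topology[OF refl]
  fix U assume U: "openin E U \<and> 0 \<in> U"
  then obtain B e where B: "bounded_in (strong_dual E) B" "e > 0"
    "\<And>x. x \<in> topspace E \<Longrightarrow> (\<And>f. f \<in> B \<Longrightarrow> \<bar>f x\<bar> \<le> e) \<Longrightarrow> x \<in> U"
    using reflexive_nhdD[OF refl] by metis
  obtain K where K: "\<forall>f\<in>B. \<forall>x\<in>C. \<bar>f x\<bar> \<le> K"
    using reflexive_uniformly_bounded[OF refl C weak B(1)] by blast
  show "absorbs U C"
  proof (rule absorbsI)
    \<comment> \<open>Beyond this radius \<open>\<bar>f x\<bar> \<le> K\<close> gives
      \<open>\<bar>f x\<bar> / \<bar>c\<bar> \<le> e\<close>; the added 1 keeps the radius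
      positive.\<close>
    show "0 < (\<bar>K\<bar> + 1) / e" using B(2) by simp
    fix c x assume c: "(\<bar>K\<bar> + 1) / e \<le> \<bar>c\<bar>" and x: "x \<in> C"
    have xE: "x \<in> topspace E" using x C by blast
    have c0: "\<bar>c\<bar> > 0" using c B(2) by (smt (verit) divide_pos_pos)
    have Kc: "\<bar>K\<bar> + 1 \<le> e * \<bar>c\<bar>" using c B(2) by (simp add: field_simps)
    show "inverse c *\<^sub>R x \<in> U"
    proof (rule B(3))
      show "inverse c *\<^sub>R x \<in> topspace E"
        using xE vector_topology_subspace[OF E] by (simp add: subspace_scale)
      fix f assume f: "f \<in> B"
      then have "f \<in> linear_ops E euclideanreal"
        using B(1) by (auto simp: bounded_in_def topspace_strong_dual)
      then have "\<bar>f (inverse c *\<^sub>R x)\<bar> = \<bar>f x\<bar> / \<bar>c\<bar>"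
        using xE by (simp add: linear_ops_scaleR abs_mult abs_inverse field_simps)
      also have "\<dots> \<le> e"
        using K f x Kc c0 by (fastforce simp: pos_divide_le_eq)
      finally show "\<bar>f (inverse c *\<^sub>R x)\<bar> \<le> e" .
    qed
  qed
qed

section \<open>Bounded predictable processes\<close>

declare split_paired_All [simp del] split_paired_Ex [simp del]

context stochastic_basis
begin

lemma subspace_bP_set: "subspace (bP_set M F)"
  unfolding subspace_def
proof (intro conjI ballI allI)
  show "0 \<in> bP_set M F"
    by (auto simp: bP_set_def zero_fun_def bounded_iff)
  show "g + h \<in> bP_set M F" if "g \<in> bP_set M F" "h \<in> bP_set M F" for g h
    using that bounded_plus_comp[of g "time_space M" h]
    by (auto simp: bP_set_def plus_fun_def)
  show "c *\<^sub>R h \<in> bP_set M F" if "h \<in> bP_set M F" for c h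
    using that bounded_scaleR_comp[of h "time_space M" c]
    by (auto simp: bP_set_def scaleR_fun_def simp del: real_scaleR_def)
qed

lemma bP_set_zero_outside: "h \<in> bP_set M F \<Longrightarrow> z \<notin> time_space M \<Longrightarrow> h z = 0"
  unfolding bP_set_def by blast

text \<open>The supremum metric is restated through uniform closeness at all \<open>z\<close>, with
  \<open>\<le>\<close> in place of a strict inequality. Ranging beyond \<open>time_space M\<close>
  changes nothing because processes vanish there.\<close>

lemma openin_bP:
  "openin (bP M F) U \<longleftrightarrow> U \<subseteq> bP_set M F \<and>
     (\<forall>g\<in>U. \<exists>e>0. \<forall>h\<in>bP_set M F. (\<forall>z. \<bar>h z - g z\<bar> \<le> e) \<longrightarrow> h \<in> U)"
  (is "_ \<longleftrightarrow> ?R")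
proof -
  interpret P: Metric_space "bP_set M F" "bP_dist M F" by (rule Metric_space_bP)
  have ne: "time_space M \<noteq> {}"
    using not_empty by (auto simp: time_space_def)
  have le: "\<bar>h z - g z\<bar> \<le> bP_dist M F g h" if gh: "g \<in> bP_set M F" "h \<in> bP_set M F" for g h z
  proof (cases "z \<in> time_space M")
    case True
    have "bounded ((\<lambda>z. g z - h z) ` time_space M)"
      using gh by (intro bounded_minus_comp) (auto simp: bP_set_def)
    then have "bdd_above ((\<lambda>z. \<bar>g z - h z\<bar>) ` time_space M)"
      by (auto simp: bounded_iff bdd_above_def)
    then have "\<bar>g z - h z\<bar> \<le> bP_dist M F g h"
      using gh True by (auto simp: bP_dist_def intro: cSUP_upper)
    then show ?thesis by (simp add: abs_minus_commute)
  next
    case False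
    then show ?thesis using gh by (simp add: bP_set_zero_outside)
  qed
  \<comment> \<open>Bounding the supremum from above requires \<open>time_space M\<close> to be
    nonempty, which \<open>ne\<close> takes from the probability space.\<close>
  have ge: "bP_dist M F g h \<le> e"
    if "g \<in> bP_set M F" "h \<in> bP_set M F" "\<And>z. \<bar>h z - g z\<bar> \<le> e" for g h e
    using that ne by (auto simp: bP_dist_def abs_minus_commute intro!: cSUP_least)
  have "(\<exists>r>0. P.mball g r \<subseteq> U) \<longleftrightarrow>
      (\<exists>e>0. \<forall>h\<in>bP_set M F. (\<forall>z. \<bar>h z - g z\<bar> \<le> e) \<longrightarrow> h \<in> U)"
    if U: "U \<subseteq> bP_set M F" and g: "g \<in> U" for g
  proof
    assume "\<exists>r>0. P.mball g r \<subseteq> U"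
    then obtain r where r: "0 < r" "P.mball g r \<subseteq> U" by blast
    \<comment> \<open>Uniform closeness bounds the distance only by \<open>\<le>\<close>; halving
      the radius makes it strictly less than \<open>r\<close>.\<close>
    have "h \<in> U" if h: "h \<in> bP_set M F" "\<forall>z. \<bar>h z - g z\<bar> \<le> r / 2" for h
    proof -
      have "bP_dist M F g h \<le> r / 2"
        using h g U by (intro ge) auto
      then have "h \<in> P.mball g r"
        using h g U r(1) by auto
      then show ?thesis using r(2) by blast
    qed
    then show "\<exists>e>0. \<forall>h\<in>bP_set M F. (\<forall>z. \<bar>h z - g z\<bar> \<le> e) \<longrightarrow> h \<in> U"
      using r(1) by (intro exI[of _ "r / 2"]) auto
  next
    assume "\<exists>e>0. \<forall>h\<in>bP_set M F. (\<forall>z. \<bar>h z - g z\<bar> \<le> e) \<longrightarrow> h \<in> U"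
    then obtain e where e: "0 < e" "\<forall>h\<in>bP_set M F. (\<forall>z. \<bar>h z - g z\<bar> \<le> e) \<longrightarrow> h \<in> U"
      by blast
    have "h \<in> U" if h': "h \<in> P.mball g e" for h
    proof -
      have h: "h \<in> bP_set M F" "bP_dist M F g h < e" using h' by auto
      have "\<bar>h z - g z\<bar> \<le> e" for z
        using le[of g h z] h g U by fastforce
      then show ?thesis using e(2) h(1) by blast
    qed
    then show "\<exists>r>0. P.mball g r \<subseteq> U" using e(1) by blast
  qed
  then show ?thesis
    unfolding bP_def P.openin_mtopology by blast
qed

lemma topspace_bP: "topspace (bP M F) = bP_set M F"
  unfolding bP_def by (rule Metric_space.topspace_mtopology[OF Metric_space_bP])

lemma bP_nhd:
  assumes "e > 0"
  shows "\<exists>U. openin (bP M F) U \<and> 0 \<in> U \<and> (\<forall>h\<in>U. \<forall>z. \<bar>h z\<bar> \<le> e)"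
proof -
  \<comment> \<open>The gap \<open>d < e\<close> is uniform in \<open>z\<close>: the functions with
    \<open>\<bar>h z\<bar> < e\<close> pointwise need not form an open set, whereas here any
    perturbation up to \<open>(e - d) / 2\<close> stays inside.\<close>
  define U where "U = {h \<in> bP_set M F. \<exists>d<e. \<forall>z. \<bar>h z\<bar> \<le> d}"
  have "\<exists>r>0. \<forall>h\<in>bP_set M F. (\<forall>z. \<bar>h z - g z\<bar> \<le> r) \<longrightarrow> h \<in> U" if "g \<in> U" for g
  proof -
    from that obtain d where d: "d < e" "\<And>z. \<bar>g z\<bar> \<le> d" by (auto simp: U_def)
    have "h \<in> U" if h: "h \<in> bP_set M F" "\<forall>z. \<bar>h z - g z\<bar> \<le> (e - d) / 2" for h
    proof -
      have "\<bar>h z\<bar> \<le> (d + e) / 2" for z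
        using h(2)[rule_format, of z] d(2)[of z] by argo
      then show ?thesis
        unfolding U_def using h(1) d(1) by (auto intro!: exI[of _ "(d + e) / 2"])
    qed
    then show ?thesis using d(1) by (intro exI[of _ "(e - d) / 2"]) auto
  qed
  then have "openin (bP M F) U"
    unfolding openin_bP by (auto simp: U_def)
  moreover have "0 \<in> U"
    using assms subspace_0[OF subspace_bP_set] by (auto simp: U_def)
  moreover have "\<bar>h z\<bar> \<le> e" if h: "h \<in> U" for h z
  proof -
    from h obtain d where "d < e" "\<forall>z. \<bar>h z\<bar> \<le> d" by (auto simp: U_def)
    then show ?thesis by (meson less_imp_le order_trans)
  qed
  ultimately show ?thesis by blast
qed

lemma bP_nhdD:
  assumes "openin (bP M F) U" "0 \<in> U"
  obtains e where "e > 0" "\<And>h. h \<in> bP_set M F \<Longrightarrow> (\<And>z. \<bar>h z\<bar> \<le> e) \<Longrightarrow> h \<in> U"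
proof -
  from assms obtain e where "e > 0" "\<forall>h\<in>bP_set M F. (\<forall>z. \<bar>h z - 0 z\<bar> \<le> e) \<longrightarrow> h \<in> U"
    unfolding openin_bP by meson
  then show ?thesis by (intro that[of e]) auto
qed

lemma vector_topology_bP: "vector_topology (bP M F)"
  unfolding vector_topology_def topspace_bP
proof (intro conjI allI ballI impI)
  fix U a assume a: "a \<in> bP_set M F" and U: "openin (bP M F) U"
  have "\<exists>e>0. \<forall>h\<in>bP_set M F. (\<forall>z. \<bar>h z - g z\<bar> \<le> e) \<longrightarrow> h \<in> {h \<in> bP_set M F. h + a \<in> U}"
    if g: "g \<in> bP_set M F" "g + a \<in> U" for g
  proof -
    obtain e where e: "e > 0" "\<forall>h\<in>bP_set M F. (\<forall>z. \<bar>h z - (g + a) z\<bar> \<le> e) \<longrightarrow> h \<in> U"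
      using U g(2) unfolding openin_bP by meson
    have "h + a \<in> U" if "h \<in> bP_set M F" "\<forall>z. \<bar>h z - g z\<bar> \<le> e" for h
      using that by (intro e(2)[rule_format]) (auto intro: subspace_add[OF subspace_bP_set _ a])
    then show ?thesis using e(1) by blast
  qed
  then show "openin (bP M F) {h \<in> bP_set M F. h + a \<in> U}"
    unfolding openin_bP by blast
next
  fix U assume "openin (bP M F) U \<and> 0 \<in> U"
  then obtain e where e: "e > 0" "\<And>h. h \<in> bP_set M F \<Longrightarrow> (\<And>z. \<bar>h z\<bar> \<le> e) \<Longrightarrow> h \<in> U"
    using bP_nhdD by metis
  obtain V where V: "openin (bP M F) V" "0 \<in> V" "\<forall>h\<in>V. \<forall>z. \<bar>h z\<bar> \<le> e / 2"
    using bP_nhd[of "e / 2"] e(1) by auto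
  have "g + h \<in> U" if "g \<in> V" "h \<in> V" for g h
  proof (rule e(2))
    show "g + h \<in> bP_set M F"
      using that V(1) by (intro subspace_add[OF subspace_bP_set]) (auto simp: openin_bP)
    fix z
    have "\<bar>g z\<bar> \<le> e / 2" "\<bar>h z\<bar> \<le> e / 2" using that V(3) by blast+
    then show "\<bar>(g + h) z\<bar> \<le> e" by simp
  qed
  then show "\<exists>V. openin (bP M F) V \<and> 0 \<in> V \<and> (\<forall>x\<in>V. \<forall>y\<in>V. x + y \<in> U)"
    using V by blast
next
  fix U c assume "openin (bP M F) U \<and> 0 \<in> U"
  then obtain e where e: "e > 0" "\<And>h. h \<in> bP_set M F \<Longrightarrow> (\<And>z. \<bar>h z\<bar> \<le> e) \<Longrightarrow> h \<in> U"
    using bP_nhdD by metis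
  \<comment> \<open>Adding 1 keeps the divisor positive when \<open>c = 0\<close>.\<close>
  obtain V where V: "openin (bP M F) V" "0 \<in> V" "\<forall>h\<in>V. \<forall>z. \<bar>h z\<bar> \<le> e / (\<bar>c\<bar> + 1)"
    using bP_nhd[of "e / (\<bar>c\<bar> + 1)"] e(1) by auto
  have "c *\<^sub>R h \<in> U" if "h \<in> V" for h
  proof (rule e(2))
    show "c *\<^sub>R h \<in> bP_set M F"
      using that V(1) by (intro subspace_scale[OF subspace_bP_set]) (auto simp: openin_bP)
    fix z
    have "\<bar>c\<bar> * \<bar>h z\<bar> \<le> (\<bar>c\<bar> + 1) * (e / (\<bar>c\<bar> + 1))"
      using that V(3) e(1) by (intro mult_mono) auto
    then show "\<bar>(c *\<^sub>R h) z\<bar> \<le> e" by (simp add: abs_mult)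
  qed
  then show "\<exists>V. openin (bP M F) V \<and> 0 \<in> V \<and> (\<forall>x\<in>V. c *\<^sub>R x \<in> U)"
    using V by blast
qed (rule subspace_bP_set)

section \<open>The pairing map\<close>

lemma bP_opsD:
  assumes "R \<in> bP_ops M F \<Psi> \<Phi>"
  shows bP_ops_linear: "\<And>z. z \<in> time_space M \<Longrightarrow> R z \<in> linear_ops \<Psi> \<Phi>"
    and bP_ops_outside: "\<And>z. z \<notin> time_space M \<Longrightarrow> R z = 0"
    and bP_ops_measurable: "\<And>f \<psi>. f \<in> topspace (strong_dual \<Phi>) \<Longrightarrow> \<psi> \<in> topspace \<Psi> \<Longrightarrow>
      (\<lambda>z. f (R z \<psi>)) \<in> borel_measurable (predictable M F)"
    and bP_ops_bounded: "\<And>B f. bounded_in \<Psi> B \<Longrightarrow> f \<in> topspace (strong_dual \<Phi>) \<Longrightarrow>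
      \<exists>K. \<forall>\<psi>\<in>B. \<forall>z\<in>time_space M. \<bar>f (R z \<psi>)\<bar> \<le> K"
proof -
  show "\<exists>K. \<forall>\<psi>\<in>B. \<forall>z\<in>time_space M. \<bar>f (R z \<psi>)\<bar> \<le> K"
    if "bounded_in \<Psi> B" "f \<in> topspace (strong_dual \<Phi>)" for B f
  proof -
    have "bdd_above {\<bar>f (R z \<psi>)\<bar> | \<psi> z. \<psi> \<in> B \<and> z \<in> time_space M}"
      using assms that by (simp add: bP_ops_def)
    then show ?thesis unfolding bdd_above_def by blast
  qed
qed (use assms in \<open>simp_all add: bP_ops_def\<close>)

lemma bP_ops_linear':
  assumes "R \<in> bP_ops M F \<Psi> \<Phi>" "vector_topology \<Psi>" "vector_topology \<Phi>"
  shows "R z \<in> linear_ops \<Psi> \<Phi>"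
  using bP_ops_linear[OF assms(1), of z] bP_ops_outside[OF assms(1), of z]
    subspace_0[OF subspace_linear_ops[OF assms(2,3)]] by (cases "z \<in> time_space M") auto

lemma subspace_bP_ops:
  assumes \<Psi>: "vector_topology \<Psi>" and \<Phi>: "vector_topology \<Phi>"
  shows "subspace (bP_ops M F \<Psi> \<Phi>)"
proof -
  note sub = subspace_linear_ops[OF \<Psi> \<Phi>]
  have I: "R \<in> bP_ops M F \<Psi> \<Phi>"
    if "\<And>z. R z \<in> linear_ops \<Psi> \<Phi>" "\<And>z. z \<notin> time_space M \<Longrightarrow> R z = 0"
      "\<And>f \<psi>. f \<in> topspace (strong_dual \<Phi>) \<Longrightarrow> \<psi> \<in> topspace \<Psi> \<Longrightarrow>
        (\<lambda>z. f (R z \<psi>)) \<in> borel_measurable (predictable M F)"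
      "\<And>B f. bounded_in \<Psi> B \<Longrightarrow> f \<in> topspace (strong_dual \<Phi>) \<Longrightarrow>
        \<exists>K. \<forall>\<psi>\<in>B. \<forall>z\<in>time_space M. \<bar>f (R z \<psi>)\<bar> \<le> K" for R
    using that unfolding bP_ops_def bdd_above_def by blast
  show ?thesis
    unfolding subspace_def
  proof (intro conjI ballI allI)
    have f0: "f 0 = 0" if "f \<in> topspace (strong_dual \<Phi>)" for f
      using that linear_ops_zero[OF _ \<Phi>] by (simp add: topspace_strong_dual)
    then show "0 \<in> bP_ops M F \<Psi> \<Phi>"
      using subspace_0[OF sub] by (intro I) auto
  next
    fix R S assume R: "R \<in> bP_ops M F \<Psi> \<Phi>" and S: "S \<in> bP_ops M F \<Psi> \<Phi>"
    \<comment> \<open>\<open>f\<close> is additive on the carrier of \<open>\<Phi>\<close> only.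
      Both operator values lie there for every \<open>z\<close> and \<open>\<psi>\<close>, default
      values included.\<close>
    have eq: "f ((R + S) z \<psi>) = f (R z \<psi>) + f (S z \<psi>)"
      if "f \<in> topspace (strong_dual \<Phi>)" for f z \<psi>
      using that linear_ops_in_topspace[OF bP_ops_linear'[OF R \<Psi> \<Phi>] \<Phi>]
        linear_ops_in_topspace[OF bP_ops_linear'[OF S \<Psi> \<Phi>] \<Phi>]
      by (simp add: topspace_strong_dual linear_ops_add)
    show "R + S \<in> bP_ops M F \<Psi> \<Phi>"
    proof (rule I)
      show "(R + S) z \<in> linear_ops \<Psi> \<Phi>" for z
        using subspace_add[OF sub bP_ops_linear'[OF R \<Psi> \<Phi>] bP_ops_linear'[OF S \<Psi> \<Phi>]] by simp
      show "(R + S) z = 0" if "z \<notin> time_space M" for z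
        using that by (simp add: bP_ops_outside[OF R] bP_ops_outside[OF S])
      show "(\<lambda>z. f ((R + S) z \<psi>)) \<in> borel_measurable (predictable M F)"
        if "f \<in> topspace (strong_dual \<Phi>)" "\<psi> \<in> topspace \<Psi>" for f \<psi>
        unfolding eq[OF that(1)]
        by (intro borel_measurable_add bP_ops_measurable[OF R that] bP_ops_measurable[OF S that])
      show "\<exists>K. \<forall>\<psi>\<in>B. \<forall>z\<in>time_space M. \<bar>f ((R + S) z \<psi>)\<bar> \<le> K"
        if B: "bounded_in \<Psi> B" "f \<in> topspace (strong_dual \<Phi>)" for B f
      proof -
        obtain K where K: "\<forall>\<psi>\<in>B. \<forall>z\<in>time_space M. \<bar>f (R z \<psi>)\<bar> \<le> K"
          using bP_ops_bounded[OF R B] by blast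
        obtain L where L: "\<forall>\<psi>\<in>B. \<forall>z\<in>time_space M. \<bar>f (S z \<psi>)\<bar> \<le> L"
          using bP_ops_bounded[OF S B] by blast
        have "\<bar>f (R z \<psi>) + f (S z \<psi>)\<bar> \<le> K + L" if "\<psi> \<in> B" "z \<in> time_space M" for \<psi> z
          using K[rule_format, OF that] L[rule_format, OF that] by linarith
        then show ?thesis unfolding eq[OF B(2)] by blast
      qed
    qed
  next
    fix c R assume R: "R \<in> bP_ops M F \<Psi> \<Phi>"
    have eq: "f ((c *\<^sub>R R) z \<psi>) = c * f (R z \<psi>)"
      if "f \<in> topspace (strong_dual \<Phi>)" for f z \<psi>
      using that linear_ops_in_topspace[OF bP_ops_linear'[OF R \<Psi> \<Phi>] \<Phi>]
      by (simp add: topspace_strong_dual linear_ops_scaleR)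
    show "c *\<^sub>R R \<in> bP_ops M F \<Psi> \<Phi>"
    proof (rule I)
      show "(c *\<^sub>R R) z \<in> linear_ops \<Psi> \<Phi>" for z
        using subspace_scale[OF sub bP_ops_linear'[OF R \<Psi> \<Phi>]] by simp
      show "(c *\<^sub>R R) z = 0" if "z \<notin> time_space M" for z
        using that by (simp add: bP_ops_outside[OF R])
      show "(\<lambda>z. f ((c *\<^sub>R R) z \<psi>)) \<in> borel_measurable (predictable M F)"
        if "f \<in> topspace (strong_dual \<Phi>)" "\<psi> \<in> topspace \<Psi>" for f \<psi>
        unfolding eq[OF that(1)]
        by (intro borel_measurable_times borel_measurable_const bP_ops_measurable[OF R that])
      show "\<exists>K. \<forall>\<psi>\<in>B. \<forall>z\<in>time_space M. \<bar>f ((c *\<^sub>R R) z \<psi>)\<bar> \<le> K"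
        if B: "bounded_in \<Psi> B" "f \<in> topspace (strong_dual \<Phi>)" for B f
      proof -
        obtain K where K: "\<forall>\<psi>\<in>B. \<forall>z\<in>time_space M. \<bar>f (R z \<psi>)\<bar> \<le> K"
          using bP_ops_bounded[OF R B] by blast
        have "\<bar>c * f (R z \<psi>)\<bar> \<le> \<bar>c\<bar> * K" if "\<psi> \<in> B" "z \<in> time_space M" for \<psi> z
          using K[rule_format, OF that] by (simp add: abs_mult mult_left_mono)
        then show ?thesis unfolding eq[OF B(2)] by blast
      qed
    qed
  qed
qed

section \<open>Linearity and injectivity of the pairing map\<close>

lemma pairing_map_apply:
  "f \<in> topspace (strong_dual \<Phi>) \<Longrightarrow> pairing_map \<Phi> R \<psi> f = (\<lambda>z. f (R z \<psi>))"
  by (simp add: pairing_map_def)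

lemma pairing_map_outside: "f \<notin> topspace (strong_dual \<Phi>) \<Longrightarrow> pairing_map \<Phi> R \<psi> f = 0"
  by (simp add: pairing_map_def)

lemma pairing_map_add:
  assumes \<Psi>: "vector_topology \<Psi>" and \<Phi>: "vector_topology \<Phi>"
    and R: "R \<in> bP_ops M F \<Psi> \<Phi>" and S: "S \<in> bP_ops M F \<Psi> \<Phi>"
  shows "pairing_map \<Phi> (R + S) = pairing_map \<Phi> R + pairing_map \<Phi> S"
proof (intro ext)
  fix \<psi> f z
  note RS = linear_ops_in_topspace[OF bP_ops_linear'[OF R \<Psi> \<Phi>] \<Phi>]
    linear_ops_in_topspace[OF bP_ops_linear'[OF S \<Psi> \<Phi>] \<Phi>]
  show "pairing_map \<Phi> (R + S) \<psi> f z = (pairing_map \<Phi> R + pairing_map \<Phi> S) \<psi> f z"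
    by (simp add: pairing_map_def topspace_strong_dual linear_ops_add RS)
qed

lemma pairing_map_scaleR:
  assumes \<Psi>: "vector_topology \<Psi>" and \<Phi>: "vector_topology \<Phi>" and R: "R \<in> bP_ops M F \<Psi> \<Phi>"
  shows "pairing_map \<Phi> (c *\<^sub>R R) = c *\<^sub>R pairing_map \<Phi> R"
proof (intro ext)
  fix \<psi> f z
  note R = linear_ops_in_topspace[OF bP_ops_linear'[OF R \<Psi> \<Phi>] \<Phi>]
  show "pairing_map \<Phi> (c *\<^sub>R R) \<psi> f z = (c *\<^sub>R pairing_map \<Phi> R) \<psi> f z"
    by (simp add: pairing_map_def topspace_strong_dual linear_ops_scaleR R)
qed

text \<open>Reflexivity makes \<open>dual_eval \<Phi>\<close> injective on the carrier, that is, the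
  dual separates the points of \<open>\<Phi>\<close>. Default values lie in the carrier, so the
  comparison covers all \<open>z\<close> and \<open>\<psi>\<close>.\<close>

lemma pairing_map_inj:
  assumes \<Psi>: "vector_topology \<Psi>" and \<Phi>: "reflexive \<Phi>"
  shows "inj_on (pairing_map \<Phi>) (bP_ops M F \<Psi> \<Phi>)"
proof (rule inj_onI, intro ext)
  fix R S z \<psi>
  assume R: "R \<in> bP_ops M F \<Psi> \<Phi>" and S: "S \<in> bP_ops M F \<Psi> \<Phi>"
    and eq: "pairing_map \<Phi> R = pairing_map \<Phi> S"
  note v\<Phi> = reflexive_vector_topology[OF \<Phi>]
  have "f (R z \<psi>) = f (S z \<psi>)" if "f \<in> topspace (strong_dual \<Phi>)" for f
    using fun_cong[OF fun_cong[OF fun_cong[OF eq]], of \<psi> f z] that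
    by (simp add: pairing_map_apply)
  then have "dual_eval \<Phi> (R z \<psi>) = dual_eval \<Phi> (S z \<psi>)"
    by (auto simp: dual_eval_def)
  then show "R z \<psi> = S z \<psi>"
    using linear_ops_in_topspace[OF bP_ops_linear'[OF R \<Psi> v\<Phi>] v\<Phi>]
      linear_ops_in_topspace[OF bP_ops_linear'[OF S \<Psi> v\<Phi>] v\<Phi>]
      bij_betw_imp_inj_on[OF reflexive_bij[OF \<Phi>]] by (blast dest: inj_onD)
qed

text \<open>The weak boundedness built into \<open>bP_ops\<close> makes the set of values
  \<open>R z \<psi>\<close> with \<open>\<psi> \<in> D\<close> weakly bounded, so the results on
  reflexive spaces apply. The first conclusion serves continuity in the functional, the second
  continuity in \<open>\<psi>\<close>.\<close>

lemma bP_ops_uniformly_bounded: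
  assumes \<Psi>: "vector_topology \<Psi>" and \<Phi>: "reflexive \<Phi>" and R: "R \<in> bP_ops M F \<Psi> \<Phi>"
    and D: "bounded_in \<Psi> D"
  shows "bounded_in \<Phi> {R z \<psi> | z \<psi>. \<psi> \<in> D}"
    and "bounded_in (strong_dual \<Phi>) B \<Longrightarrow> \<exists>K. \<forall>f\<in>B. \<forall>\<psi>\<in>D. \<forall>z. \<bar>f (R z \<psi>)\<bar> \<le> K"
proof -
  note v\<Phi> = reflexive_vector_topology[OF \<Phi>]
  have sub: "{R z \<psi> | z \<psi>. \<psi> \<in> D} \<subseteq> topspace \<Phi>"
    using linear_ops_in_topspace[OF bP_ops_linear'[OF R \<Psi> v\<Phi>] v\<Phi>] by blast
  have weak: "\<exists>K. \<forall>x\<in>{R z \<psi> | z \<psi>. \<psi> \<in> D}. \<bar>f x\<bar> \<le> K"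
    if f: "f \<in> topspace (strong_dual \<Phi>)" for f
  proof -
    obtain K where K: "\<forall>\<psi>\<in>D. \<forall>z\<in>time_space M. \<bar>f (R z \<psi>)\<bar> \<le> K"
      using bP_ops_bounded[OF R D f] by blast
    have f0: "f 0 = 0"
      using f linear_ops_zero[OF _ v\<Phi>] by (simp add: topspace_strong_dual)
    \<comment> \<open>\<open>K\<close> is a bound on \<open>time_space M\<close> only; elsewhere the
      value is \<open>f 0 = 0\<close>, which the maximum with 0 covers.\<close>
    have "\<bar>f (R z \<psi>)\<bar> \<le> max K 0" if "\<psi> \<in> D" for z \<psi>
      using K that f0 by (cases "z \<in> time_space M") (auto simp: bP_ops_outside[OF R] le_max_iff_disj)
    then show ?thesis by blast
  qed
  show "bounded_in \<Phi> {R z \<psi> | z \<psi>. \<psi> \<in> D}"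
    using \<Phi> sub weak by (rule reflexive_bounded_in)
  show "\<exists>K. \<forall>f\<in>B. \<forall>\<psi>\<in>D. \<forall>z. \<bar>f (R z \<psi>)\<bar> \<le> K" if "bounded_in (strong_dual \<Phi>) B"
    using reflexive_uniformly_bounded[OF \<Phi> sub weak that] by blast
qed

section \<open>Continuity of the operators produced by the pairing map\<close>

lemma pairing_map_in:
  assumes \<Psi>: "bornological \<Psi>" and \<Phi>: "reflexive \<Phi>" and R: "R \<in> bP_ops M F \<Psi> \<Phi>"
  shows "pairing_map \<Phi> R \<in> linear_ops \<Psi> (Lb (strong_dual \<Phi>) (bP M F))"
proof -
  have lcs: "locally_convex_space \<Psi>" using \<Psi> unfolding bornological_def by blast
  note v\<Phi> = reflexive_vector_topology[OF \<Phi>]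
  note v\<Psi> = locally_convex_space_vector_topology[OF lcs]
  note vD = vector_topology_strong_dual[OF v\<Phi>]
  note vL = vector_topology_Lb[OF vD vector_topology_bP]
  note RL = bP_ops_linear'[OF R v\<Psi> v\<Phi>]
  note Rin = linear_ops_in_topspace[OF RL v\<Phi>]
  have dual0: "f 0 = 0" if "f \<in> topspace (strong_dual \<Phi>)" for f
    using that linear_ops_zero[OF _ v\<Phi>] by (simp add: topspace_strong_dual)
  have into: "pairing_map \<Phi> R \<psi> \<in> linear_ops (strong_dual \<Phi>) (bP M F)"
    if \<psi>: "\<psi> \<in> topspace \<Psi>" for \<psi>
  proof (rule linear_opsI[OF vD vector_topology_bP])
    note b\<psi> = bounded_in_singleton[OF lcs \<psi>]
    show inbP: "pairing_map \<Phi> R \<psi> f \<in> topspace (bP M F)" if f: "f \<in> topspace (strong_dual \<Phi>)" for f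
    proof -
      obtain K where "\<forall>z\<in>time_space M. \<bar>f (R z \<psi>)\<bar> \<le> K"
        using bP_ops_bounded[OF R b\<psi> f] by blast
      then have "bounded ((\<lambda>z. f (R z \<psi>)) ` time_space M)"
        by (auto simp: bounded_iff)
      then show ?thesis
        unfolding topspace_bP bP_set_def pairing_map_apply[OF f]
        using bP_ops_measurable[OF R f \<psi>] bP_ops_outside[OF R] dual0[OF f] by simp
    qed
    show "pairing_map \<Phi> R \<psi> (f + g) = pairing_map \<Phi> R \<psi> f + pairing_map \<Phi> R \<psi> g"
      if "f \<in> topspace (strong_dual \<Phi>)" "g \<in> topspace (strong_dual \<Phi>)" for f g
      using that subspace_add[OF vector_topology_subspace[OF vD]]
      by (simp add: pairing_map_apply fun_eq_iff)
    show "pairing_map \<Phi> R \<psi> (c *\<^sub>R f) = c *\<^sub>R pairing_map \<Phi> R \<psi> f"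
      if "f \<in> topspace (strong_dual \<Phi>)" for c f
      using that subspace_scale[OF vector_topology_subspace[OF vD]]
      by (simp add: pairing_map_apply fun_eq_iff)
    show "pairing_map \<Phi> R \<psi> f = 0" if "f \<notin> topspace (strong_dual \<Phi>)" for f
      using that by (rule pairing_map_outside)
    fix U assume U: "openin (bP M F) U" "0 \<in> U"
    obtain e where e: "e > 0" "\<And>h. h \<in> bP_set M F \<Longrightarrow> (\<And>z. \<bar>h z\<bar> \<le> e) \<Longrightarrow> h \<in> U"
      using bP_nhdD[OF U] by metis
    \<comment> \<open>The values \<open>R z \<psi>\<close> at the fixed \<open>\<psi>\<close> form a
      bounded set, so the strong dual has a neighbourhood of 0 whose members are at most
      \<open>e\<close> on all of them, that is, uniformly in \<open>z\<close>.\<close>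
    obtain W where W: "openin (strong_dual \<Phi>) W" "0 \<in> W"
      "\<forall>f\<in>W. \<forall>x\<in>{R z \<psi>' | z \<psi>'. \<psi>' \<in> {\<psi>}}. \<bar>f x\<bar> \<le> e"
      using strong_dual_nhd[OF v\<Phi> bP_ops_uniformly_bounded(1)[OF v\<Psi> \<Phi> R b\<psi>] e(1)] by blast
    have "pairing_map \<Phi> R \<psi> f \<in> U" if f: "f \<in> W" for f
    proof (rule e(2))
      have fd: "f \<in> topspace (strong_dual \<Phi>)" using f openin_subset[OF W(1)] by blast
      show "pairing_map \<Phi> R \<psi> f \<in> bP_set M F"
        using inbP[OF fd]
        by (simp add: topspace_bP)
      show "\<bar>pairing_map \<Phi> R \<psi> f z\<bar> \<le> e" for z
        using W(3) f by (auto simp: pairing_map_apply[OF fd])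
    qed
    then show "\<exists>V. openin (strong_dual \<Phi>) V \<and> 0 \<in> V \<and> (\<forall>f\<in>V. pairing_map \<Phi> R \<psi> f \<in> U)"
      using W by blast
  qed
  show ?thesis
  proof (rule linear_opsI[OF v\<Psi> vL])
    show "pairing_map \<Phi> R \<psi> \<in> topspace (Lb (strong_dual \<Phi>) (bP M F))" if "\<psi> \<in> topspace \<Psi>" for \<psi>
      using into[OF that] by (simp add: topspace_Lb vector_topology_zero[OF vector_topology_bP])
    show "pairing_map \<Phi> R (\<psi> + \<eta>) = pairing_map \<Phi> R \<psi> + pairing_map \<Phi> R \<eta>"
      if "\<psi> \<in> topspace \<Psi>" "\<eta> \<in> topspace \<Psi>" for \<psi> \<eta>
      using that by (auto simp: pairing_map_def fun_eq_iff linear_ops_add[OF RL] topspace_strong_dual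
          linear_ops_add Rin)
    show "pairing_map \<Phi> R (c *\<^sub>R \<psi>) = c *\<^sub>R pairing_map \<Phi> R \<psi>" if "\<psi> \<in> topspace \<Psi>" for c \<psi>
      using that by (auto simp: pairing_map_def fun_eq_iff linear_ops_scaleR[OF RL]
          topspace_strong_dual linear_ops_scaleR Rin)
    show "pairing_map \<Phi> R \<psi> = 0" if "\<psi> \<notin> topspace \<Psi>" for \<psi>
      using that by (auto simp: pairing_map_def fun_eq_iff linear_ops_out[OF RL] dual0)
    fix W assume W: "openin (Lb (strong_dual \<Phi>) (bP M F)) W" "0 \<in> W"
    obtain B U where B: "bounded_in (strong_dual \<Phi>) B" and U: "openin (bP M F) U" "0 \<in> U"
      and BU: "\<And>v. v \<in> linear_ops (strong_dual \<Phi>) (bP M F) \<Longrightarrow> (\<And>f. f \<in> B \<Longrightarrow> v f \<in> U) \<Longrightarrow> v \<in> W"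
      using Lb_nhdD[OF W] by metis
    obtain e where e: "e > 0" "\<And>h. h \<in> bP_set M F \<Longrightarrow> (\<And>z. \<bar>h z\<bar> \<le> e) \<Longrightarrow> h \<in> U"
      using bP_nhdD[OF U] by metis
    have Bd: "f \<in> topspace (strong_dual \<Phi>)" if "f \<in> B" for f
      using that B by (auto simp: bounded_in_def)
    then have Bl: "f \<in> linear_ops \<Phi> euclideanreal" if "f \<in> B" for f
      using that by (simp add: topspace_strong_dual)
    \<comment> \<open>Continuity of the single operators \<open>R z\<close> gives no neighbourhood
      that works for all \<open>z\<close> at once. So \<open>N\<close> is shown to be convex,
      balanced and absorbing for bounded sets, and the bornological property of
      \<open>\<Psi>\<close> supplies the neighbourhood.\<close>
    define N where "N = {\<psi> \<in> topspace \<Psi>. \<forall>f\<in>B. \<forall>z. \<bar>f (R z \<psi>)\<bar> \<le> e}"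
    have fadd: "f (R z (a *\<^sub>R \<psi> + b *\<^sub>R \<eta>)) = a * f (R z \<psi>) + b * f (R z \<eta>)"
      if "f \<in> B" "\<psi> \<in> topspace \<Psi>" "\<eta> \<in> topspace \<Psi>" for f z a b \<psi> \<eta>
      using that vector_topology_subspace[OF v\<Psi>] vector_topology_subspace[OF v\<Phi>]
      by (simp add: linear_ops_add[OF RL] linear_ops_scaleR[OF RL] linear_ops_add[OF Bl]
          linear_ops_scaleR[OF Bl] Rin subspace_scale)
    have fscale: "f (R z (c *\<^sub>R \<psi>)) = c * f (R z \<psi>)"
      if "f \<in> B" "\<psi> \<in> topspace \<Psi>" for f z c \<psi>
      using that by (simp add: linear_ops_scaleR[OF RL] linear_ops_scaleR[OF Bl] Rin)
    have "convex N"
    proof (rule convexI)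
      fix \<psi> \<eta> and a b :: real assume *: "\<psi> \<in> N" "\<eta> \<in> N" "0 \<le> a" "0 \<le> b" "a + b = 1"
      have "\<bar>a * f (R z \<psi>) + b * f (R z \<eta>)\<bar> \<le> e" if "f \<in> B" for f z
      proof -
        have "a * \<bar>f (R z \<psi>)\<bar> \<le> a * e" "b * \<bar>f (R z \<eta>)\<bar> \<le> b * e"
          using * that by (auto simp: N_def intro!: mult_left_mono)
        moreover have "a * e + b * e = e"
          using *(5) by (metis distrib_right mult_1)
        moreover have "\<bar>a * f (R z \<psi>) + b * f (R z \<eta>)\<bar> \<le> a * \<bar>f (R z \<psi>)\<bar> + b * \<bar>f (R z \<eta>)\<bar>"
          using abs_triangle_ineq[of "a * f (R z \<psi>)" "b * f (R z \<eta>)"] *(3,4) by (simp add: abs_mult)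
        ultimately show ?thesis by linarith
      qed
      then show "a *\<^sub>R \<psi> + b *\<^sub>R \<eta> \<in> N"
        using * vector_topology_subspace[OF v\<Psi>]
        by (auto simp: N_def fadd intro!: subspace_add subspace_scale)
    qed
    moreover have "balanced N"
      unfolding balanced_def
    proof (intro allI ballI impI)
      fix c :: real and \<psi> assume *: "\<psi> \<in> N" "\<bar>c\<bar> \<le> 1"
      have "\<bar>c * f (R z \<psi>)\<bar> \<le> e" if "f \<in> B" for f z
      proof -
        have "\<bar>c\<bar> * \<bar>f (R z \<psi>)\<bar> \<le> 1 * e"
          using * that by (intro mult_mono) (auto simp: N_def)
        then show ?thesis by (simp add: abs_mult)
      qed
      then show "c *\<^sub>R \<psi> \<in> N"
        using * vector_topology_subspace[OF v\<Psi>] by (auto simp: N_def fscale intro!: subspace_scale)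
    qed
    moreover have "absorbs N D" if D: "bounded_in \<Psi> D" for D
    proof -
      \<comment> \<open>The bound is uniform over \<open>B\<close>, \<open>D\<close> and all
        \<open>z\<close>, so one radius, \<open>(\<bar>K\<bar> + 1) / e\<close>, absorbs all of
        \<open>D\<close>.\<close>
      obtain K where K: "\<forall>f\<in>B. \<forall>\<psi>\<in>D. \<forall>z. \<bar>f (R z \<psi>)\<bar> \<le> K"
        using bP_ops_uniformly_bounded(2)[OF v\<Psi> \<Phi> R D B] by blast
      show ?thesis
      proof (rule absorbsI)
        show "0 < (\<bar>K\<bar> + 1) / e" using e(1) by simp
        fix c :: real and \<psi> assume c: "(\<bar>K\<bar> + 1) / e \<le> \<bar>c\<bar>" and \<psi>: "\<psi> \<in> D"
        have "0 < (\<bar>K\<bar> + 1) / e" using e(1) by simp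
        then have c0: "\<bar>c\<bar> > 0" using c by linarith
        have Kc: "\<bar>K\<bar> + 1 \<le> e * \<bar>c\<bar>" using c e(1) by (simp add: field_simps)
        have \<psi>T: "\<psi> \<in> topspace \<Psi>" using \<psi> D by (auto simp: bounded_in_def)
        have "\<bar>inverse c * f (R z \<psi>)\<bar> \<le> e" if f: "f \<in> B" for f z
        proof -
          have "\<bar>f (R z \<psi>)\<bar> \<le> K" using K f \<psi> by blast
          then have "\<bar>f (R z \<psi>)\<bar> \<le> e * \<bar>c\<bar>" using Kc by linarith
          then have "\<bar>f (R z \<psi>)\<bar> / \<bar>c\<bar> \<le> e" using c0 by (simp add: pos_divide_le_eq)
          then show ?thesis by (simp add: abs_mult abs_inverse divide_inverse mult.commute)
        qed
        then show "inverse c *\<^sub>R \<psi> \<in> N"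
          using \<psi>T vector_topology_subspace[OF v\<Psi>] by (auto simp: N_def fscale intro!: subspace_scale)
      qed
    qed
    moreover have "N \<subseteq> topspace \<Psi>" by (auto simp: N_def)
    ultimately obtain V where V: "openin \<Psi> V" "0 \<in> V" "V \<subseteq> N"
      using \<Psi> unfolding bornological_def by meson
    have "pairing_map \<Phi> R \<psi> \<in> W" if "\<psi> \<in> V" for \<psi>
    proof (rule BU)
      have \<psi>: "\<psi> \<in> N" using that V(3) by blast
      then show in\<psi>: "pairing_map \<Phi> R \<psi> \<in> linear_ops (strong_dual \<Phi>) (bP M F)"
        by (intro into) (simp add: N_def)
      fix f assume f: "f \<in> B"
      show "pairing_map \<Phi> R \<psi> f \<in> U"
      proof (rule e(2))
        show "pairing_map \<Phi> R \<psi> f \<in> bP_set M F"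
          using linear_ops_in[OF in\<psi> Bd[OF f]] by (simp add: topspace_bP)
        show "\<bar>pairing_map \<Phi> R \<psi> f z\<bar> \<le> e" for z
          using \<psi> f by (simp add: pairing_map_apply[OF Bd[OF f]] N_def)
      qed
    qed
    then show "\<exists>V. openin \<Psi> V \<and> 0 \<in> V \<and> (\<forall>\<psi>\<in>V. pairing_map \<Phi> R \<psi> \<in> W)"
      using V(1,2) by blast
  qed
qed

section \<open>Surjectivity of the pairing map\<close>

lemma pairing_map_surj:
  assumes lcs: "locally_convex_space \<Psi>" and \<Phi>: "reflexive \<Phi>"
    and S: "S \<in> linear_ops \<Psi> (Lb (strong_dual \<Phi>) (bP M F))"
  shows "\<exists>R\<in>bP_ops M F \<Psi> \<Phi>. pairing_map \<Phi> R = S"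
proof -
  note v\<Phi> = reflexive_vector_topology[OF \<Phi>]
  note v\<Psi> = locally_convex_space_vector_topology[OF lcs]
  note vD = vector_topology_strong_dual[OF v\<Phi>]
  note vL = vector_topology_Lb[OF vD vector_topology_bP]
  let ?T = "\<lambda>z \<psi> f. S \<psi> f z"
  have topL: "topspace (Lb (strong_dual \<Phi>) (bP M F)) = linear_ops (strong_dual \<Phi>) (bP M F)"
    by (simp add: topspace_Lb vector_topology_zero[OF vector_topology_bP])
  have S\<psi>: "S \<psi> \<in> linear_ops (strong_dual \<Phi>) (bP M F)" for \<psi>
    using linear_ops_in_topspace[OF S vL] by (simp add: topL)
  have Sf: "S \<psi> f \<in> bP_set M F" for \<psi> f
    using linear_ops_in_topspace[OF S\<psi> vector_topology_bP] by (simp add: topspace_bP)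
  \<comment> \<open>Evaluation at \<open>z\<close> is dominated by the uniform norm, so composing it
    with the continuous \<open>S \<psi>\<close> gives a continuous functional on the strong dual, an
    element of the bidual.\<close>
  have Tin: "?T z \<psi> \<in> topspace (strong_dual (strong_dual \<Phi>))" for z \<psi>
    unfolding topspace_strong_dual[of "strong_dual \<Phi>"]
  proof (rule linear_opsI[OF vD vector_topology_real])
    fix U :: "real set" assume U: "openin euclideanreal U" "0 \<in> U"
    then have "open U" by simp
    then obtain e where e: "e > 0" "\<And>x. \<bar>x\<bar> \<le> e \<Longrightarrow> x \<in> U"
      using U(2) open_real_ball_zero by metis
    obtain U' where U': "openin (bP M F) U'" "0 \<in> U'" "\<forall>h\<in>U'. \<forall>z. \<bar>h z\<bar> \<le> e"
      using bP_nhd[OF e(1)] by blast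
    obtain V where "openin (strong_dual \<Phi>) V" "0 \<in> V" "\<forall>f\<in>V. S \<psi> f \<in> U'"
      using linear_ops_nhd[OF S\<psi> vD U'(1,2)] by blast
    then show "\<exists>V. openin (strong_dual \<Phi>) V \<and> 0 \<in> V \<and> (\<forall>f\<in>V. S \<psi> f z \<in> U)"
      using U'(3) e(2) by blast
  qed (simp_all add: linear_ops_add[OF S\<psi>] linear_ops_scaleR[OF S\<psi>] linear_ops_out[OF S\<psi>])
  \<comment> \<open>Reflexivity represents this functional by a unique vector of
    \<open>\<Phi>\<close>, the only possible value at \<open>z\<close> and \<open>\<psi>\<close> of
    a preimage of \<open>S\<close>.\<close>
  define R where "R z \<psi> = the_inv_into (topspace \<Phi>) (dual_eval \<Phi>) (?T z \<psi>)" for z \<psi>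
  have inj: "inj_on (dual_eval \<Phi>) (topspace \<Phi>)"
    and img: "dual_eval \<Phi> ` topspace \<Phi> = topspace (strong_dual (strong_dual \<Phi>))"
    using reflexive_bij[OF \<Phi>] by (auto simp: bij_betw_def)
  have Rin: "R z \<psi> \<in> topspace \<Phi>" for z \<psi>
    unfolding R_def using Tin img by (intro the_inv_into_into[OF inj]) auto
  have RT: "dual_eval \<Phi> (R z \<psi>) = ?T z \<psi>" for z \<psi>
    unfolding R_def using Tin img by (intro f_the_inv_into_f[OF inj]) simp
  have pair: "f (R z \<psi>) = S \<psi> f z" if "f \<in> topspace (strong_dual \<Phi>)" for f z \<psi>
    using fun_cong[OF RT[of z \<psi>], of f] reflexive_dual_eval[OF \<Phi> that] by simp
  \<comment> \<open>Uniqueness of the representing vector: \<open>R z \<psi>\<close> is identified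
    by testing against the dual. Linearity of \<open>R z\<close> and the default values are obtained
    this way.\<close>
  have Rx: "R z \<psi> = x"
    if x: "x \<in> topspace \<Phi>" and fx: "\<And>f. f \<in> topspace (strong_dual \<Phi>) \<Longrightarrow> f x = S \<psi> f z" for z \<psi> x
  proof -
    have "f (R z \<psi>) = f x" if "f \<in> topspace (strong_dual \<Phi>)" for f
      unfolding pair[OF that] fx[OF that] ..
    then have "dual_eval \<Phi> (R z \<psi>) = dual_eval \<Phi> x"
      by (auto simp: dual_eval_def)
    then show ?thesis using inj Rin x by (blast dest: inj_onD)
  qed
  have dual0: "f 0 = 0" if "f \<in> topspace (strong_dual \<Phi>)" for f
    using that linear_ops_zero[OF _ v\<Phi>] by (simp add: topspace_strong_dual)
  have S0: "R z \<psi> = 0" if "\<And>f. S \<psi> f z = 0" for z \<psi>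
    using that by (intro Rx vector_topology_zero[OF v\<Phi>]) (simp add: dual0)
  \<comment> \<open>Continuity of \<open>S\<close>, unpacked into a bound uniform in
    \<open>z\<close>. It is used with a \<open>B\<close> that describes a neighbourhood in
    \<open>\<Phi>\<close>, for continuity of \<open>R z\<close>, and with a singleton
    \<open>B\<close>, for weak boundedness of \<open>R\<close>.\<close>
  have nhd: "\<exists>V. openin \<Psi> V \<and> 0 \<in> V \<and> (\<forall>\<psi>\<in>V. \<forall>f\<in>B. \<forall>z. \<bar>S \<psi> f z\<bar> \<le> e)"
    if B: "bounded_in (strong_dual \<Phi>) B" and e: "e > 0" for B e
  proof -
    obtain U where U: "openin (bP M F) U" "0 \<in> U" "\<forall>h\<in>U. \<forall>z. \<bar>h z\<bar> \<le> e"
      using bP_nhd[OF e] by blast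
    obtain W where W: "openin (Lb (strong_dual \<Phi>) (bP M F)) W" "0 \<in> W" "\<forall>v\<in>W. \<forall>f\<in>B. v f \<in> U"
      using Lb_nhd[OF vector_topology_bP vD B U(1,2)] by blast
    obtain V where "openin \<Psi> V" "0 \<in> V" "\<forall>\<psi>\<in>V. S \<psi> \<in> W"
      using linear_ops_nhd[OF S v\<Psi> W(1,2)] by blast
    then show ?thesis using U(3) W(3) by blast
  qed
  have "R z \<in> linear_ops \<Psi> \<Phi>" for z
  proof (rule linear_opsI[OF v\<Psi> v\<Phi>])
    show "R z \<psi> \<in> topspace \<Phi>" for \<psi> by (rule Rin)
    show "R z (\<psi> + \<eta>) = R z \<psi> + R z \<eta>" if "\<psi> \<in> topspace \<Psi>" "\<eta> \<in> topspace \<Psi>" for \<psi> \<eta>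
    proof (rule Rx)
      show "R z \<psi> + R z \<eta> \<in> topspace \<Phi>"
        using Rin vector_topology_subspace[OF v\<Phi>] by (intro subspace_add)
      fix f assume f: "f \<in> topspace (strong_dual \<Phi>)"
      then have "f (R z \<psi> + R z \<eta>) = f (R z \<psi>) + f (R z \<eta>)"
        using Rin by (simp add: topspace_strong_dual linear_ops_add)
      then show "f (R z \<psi> + R z \<eta>) = S (\<psi> + \<eta>) f z"
        by (simp add: pair[OF f] linear_ops_add[OF S that])
    qed
    show "R z (c *\<^sub>R \<psi>) = c *\<^sub>R R z \<psi>" if "\<psi> \<in> topspace \<Psi>" for c \<psi>
    proof (rule Rx)
      show "c *\<^sub>R R z \<psi> \<in> topspace \<Phi>"
        using Rin vector_topology_subspace[OF v\<Phi>] by (intro subspace_scale)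
      fix f assume f: "f \<in> topspace (strong_dual \<Phi>)"
      then have "f (c *\<^sub>R R z \<psi>) = c * f (R z \<psi>)"
        using Rin by (simp add: topspace_strong_dual linear_ops_scaleR)
      then show "f (c *\<^sub>R R z \<psi>) = S (c *\<^sub>R \<psi>) f z"
        by (simp add: pair[OF f] linear_ops_scaleR[OF S that])
    qed
    show "R z \<psi> = 0" if "\<psi> \<notin> topspace \<Psi>" for \<psi>
      by (rule S0) (simp add: linear_ops_out[OF S that])
    fix U assume U: "openin \<Phi> U" "0 \<in> U"
    \<comment> \<open>\<open>U\<close> is traded for a strongly bounded set \<open>B\<close> of
      functionals, on which \<open>nhd\<close> controls \<open>S\<close>.\<close>
    obtain B e where B: "bounded_in (strong_dual \<Phi>) B" "e > 0"
      "\<And>x. x \<in> topspace \<Phi> \<Longrightarrow> (\<And>f. f \<in> B \<Longrightarrow> \<bar>f x\<bar> \<le> e) \<Longrightarrow> x \<in> U"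
      using reflexive_nhdD[OF \<Phi> U] by metis
    obtain V where V: "openin \<Psi> V" "0 \<in> V" "\<forall>\<psi>\<in>V. \<forall>f\<in>B. \<forall>z. \<bar>S \<psi> f z\<bar> \<le> e"
      using nhd[OF B(1,2)] by blast
    have "R z \<psi> \<in> U" if "\<psi> \<in> V" for \<psi>
    proof (rule B(3)[OF Rin])
      fix f assume f: "f \<in> B"
      then have "f \<in> topspace (strong_dual \<Phi>)" using B(1) by (auto simp: bounded_in_def)
      then show "\<bar>f (R z \<psi>)\<bar> \<le> e" using V(3) that f by (simp add: pair)
    qed
    then show "\<exists>V. openin \<Psi> V \<and> 0 \<in> V \<and> (\<forall>\<psi>\<in>V. R z \<psi> \<in> U)"
      using V by blast
  qed
  moreover have "R z = 0" if "z \<notin> time_space M" for z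
    using bP_set_zero_outside[OF Sf that] by (intro ext) (simp add: S0)
  moreover have "(\<lambda>z. f (R z \<psi>)) \<in> borel_measurable (predictable M F)"
    if "f \<in> topspace (strong_dual \<Phi>)" for f \<psi>
    using Sf[of \<psi> f] by (simp add: pair[OF that] bP_set_def)
  moreover have "\<exists>K. \<forall>\<psi>\<in>B. \<forall>z\<in>time_space M. \<bar>f (R z \<psi>)\<bar> \<le> K"
    if B: "bounded_in \<Psi> B" and f: "f \<in> topspace (strong_dual \<Phi>)" for B f
  proof -
    have "bounded_in (strong_dual \<Phi>) {f}"
      using bounded_in_Lb_singleton[OF v\<Phi> vector_topology_real, of f] f
      by (simp add: topspace_strong_dual) (simp add: strong_dual_def)
    from nhd[OF this zero_less_one]
    obtain V where V: "openin \<Psi> V" "0 \<in> V" "\<forall>\<psi>\<in>V. \<forall>z. \<bar>S \<psi> f z\<bar> \<le> 1"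
      by auto
    have "absorbs V B" using B V(1,2) by (simp add: bounded_in_def)
    then obtain r where r: "r > 0" "\<And>\<psi>. \<psi> \<in> B \<Longrightarrow> \<exists>\<eta>\<in>V. \<psi> = r *\<^sub>R \<eta>"
      by (rule absorbs_scaled) blast
    \<comment> \<open>On \<open>V\<close> the pairing with \<open>f\<close> is at most 1, so the
      factor \<open>r\<close> with which \<open>V\<close> absorbs \<open>B\<close> is the bound on
      \<open>B\<close>.\<close>
    have "\<bar>f (R z \<psi>)\<bar> \<le> r" if "\<psi> \<in> B" for \<psi> z
    proof -
      from r(2)[OF that] obtain \<eta> where \<eta>: "\<eta> \<in> V" "\<psi> = r *\<^sub>R \<eta>" by blast
      then have "\<eta> \<in> topspace \<Psi>" using openin_subset[OF V(1)] by blast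
      then have "S \<psi> f z = r * S \<eta> f z"
        by (simp add: \<eta>(2) linear_ops_scaleR[OF S])
      moreover have "\<bar>S \<eta> f z\<bar> \<le> 1" using V(3) \<eta>(1) by blast
      ultimately show ?thesis using r(1) by (simp add: pair[OF f] abs_mult mult_left_le)
    qed
    then show ?thesis by blast
  qed
  ultimately have "R \<in> bP_ops M F \<Psi> \<Phi>"
    unfolding bP_ops_def bdd_above_def by blast
  \<comment> \<open>Equality of total functions includes \<open>f\<close> outside the dual, where
    both sides take the default value 0.\<close>
  moreover have "pairing_map \<Phi> R \<psi> f = S \<psi> f" for \<psi> f
    by (cases "f \<in> topspace (strong_dual \<Phi>)")
      (simp_all add: pairing_map_apply pairing_map_outside pair linear_ops_out[OF S\<psi>])
  ultimately show ?thesis by blast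
qed

end

theorem proposition4p4:
  fixes M :: "'w measure" and F :: "real \<Rightarrow> 'w measure"
    and \<Phi> :: "'b::real_vector topology" and \<Psi> :: "'a::real_vector topology"
  assumes "stochastic_basis M F"
    and "locally_convex_space \<Phi>" and "locally_convex_space \<Psi>"
    and "bornological \<Psi>" and "reflexive \<Phi>"
  shows "linear_isomorphism_on
           (bP_ops M F \<Psi> \<Phi>)
           (linear_ops \<Psi> (Lb (strong_dual \<Phi>) (bP M F)))
           (pairing_map \<Phi>)"
proof -
  interpret stochastic_basis M F by (rule assms(1))
  note v\<Phi> = locally_convex_space_vector_topology[OF assms(2)]
  note v\<Psi> = locally_convex_space_vector_topology[OF assms(3)]
  note vL = vector_topology_Lb[OF vector_topology_strong_dual[OF v\<Phi>] vector_topology_bP]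
  have "bij_betw (pairing_map \<Phi>) (bP_ops M F \<Psi> \<Phi>) (linear_ops \<Psi> (Lb (strong_dual \<Phi>) (bP M F)))"
    unfolding bij_betw_def
  proof (intro conjI equalityI image_subsetI subsetI)
    show "inj_on (pairing_map \<Phi>) (bP_ops M F \<Psi> \<Phi>)"
      by (rule pairing_map_inj[OF v\<Psi> assms(5)])
    show "pairing_map \<Phi> R \<in> linear_ops \<Psi> (Lb (strong_dual \<Phi>) (bP M F))"
      if "R \<in> bP_ops M F \<Psi> \<Phi>" for R
      by (rule pairing_map_in[OF assms(4,5) that])
    show "S \<in> pairing_map \<Phi> ` bP_ops M F \<Psi> \<Phi>"
      if "S \<in> linear_ops \<Psi> (Lb (strong_dual \<Phi>) (bP M F))" for S
      using pairing_map_surj[OF assms(3,5) that] by blast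
  qed
  then show ?thesis
    unfolding linear_isomorphism_on_def
    using subspace_bP_ops[OF v\<Psi> v\<Phi>] subspace_linear_ops[OF v\<Psi> vL]
      pairing_map_add[OF v\<Psi> v\<Phi>] pairing_map_scaleR[OF v\<Psi> v\<Phi>] by blast
qed

end
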